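(* Let $V$ be a vector space of dimension $d$ over a field $F$, let $v_1,\dots,v_d$ be a basis of $V$ and let $v^1,\dots,v^d$ be the corresponding dual basis of $V^\vee$. Then $$D\bigl(\mathrm L[v_1,\dots,v_d]\bigr)=(-1)^d\,\mathrm I[v^d,\dots,v^1],\qquad D\bigl(\mathrm I[v_1,\dots,v_d]\bigr)=(-1)^d\,\mathrm L[v^d,\dots,v^1].$$
   Context: **Steinberg module.** For a $d$-dimensional vector space $V$ over $F$, $\mathrm{St}(V)=\widetilde H_{d-2}(\mathcal T_V,\mathbb Q)$ ($\mathcal T_V$ the Tits building), with $\mathrm{St}(V)=\mathbb Q$ if $d\le 1$. Equivalently it is the $\mathbb Q$-vector space generated by apartments $[v_1,\dots,v_d]$, $v_i\in V\setminus\{0\}$, which vanish for linearly dependent $v_i$, are skew-symmetric, are unchanged when a $v_i$ is multiplied by an element of $F^\times$, and satisfy $\sum_{i=0}^d(-1)^i[v_0,\dots,\widehat{v_i},\dots,v_d]=0$ for nonzero $v_0,\dots,v_d\in V$. For lines $P_i=\langle v_i\rangle$ write $[P_1,\dots,P_d]=[v_1,\dots,v_d]$. Put $\mathrm{St}^2(V)=\mathrm{St}(V)\otimes_{\mathbb Q}\mathrm{St}(V)$. **Duality.** Lines in $V^\vee$ correspond to hyperplanes in $V$ via $\langle\varphi\rangle\leftrightarrow\ker\varphi$. For lines $\mathcal P=(P_1,\dots,P_d)$ spanning $V$, put $\mathcal P^\vee=(H_1,\dots,H_d)$ with $H_i=\langle P_1,\dots,\widehat{P_i},\dots,P_d\rangle$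 regarded as a line in $V^\vee$, and $[\mathcal P^\vee]=[H_1,\dots,H_d]\in\mathrm{St}(V^\vee)$. The duality isomorphism $D:\mathrm{St}^2(V)\to\mathrm{St}^2(V^\vee)$ is the (well-defined) linear map with $D([\mathcal P]\otimes[\mathcal Q])=[\mathcal Q^\vee]\otimes[\mathcal P^\vee]$. **Steinberg polylogarithms and iterated integrals.** For a basis $v_1,\dots,v_d$ of a vector space, $$\mathrm L[v_1,\dots,v_d]=[v_d,v_d+v_{d-1},\dots,v_d+\dots+v_1]\otimes[v_d,v_{d-1},\dots,v_1],$$ $$\mathrm I[v_1,\dots,v_d]=(-1)^d[v_d,v_{d-1},\dots,v_1]\otimes[v_d,v_{d-1}-v_d,\dots,v_1-v_2].$$ *)

theory Defs
  imports
    Complex_Main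
    "HOL-Algebra.Module"
    "HOL-Library.Poly_Mapping"
    "HOL-Library.Function_Algebras"
    "HOL-Combinatorics.Permutations"
begin

section \<open>Rational vector spaces by generators and relations\<close>

text \<open>Rational vector spaces are represented by records of type \<open>(rat, 'b) module\<close>; the fields
  for the ring multiplication and its unit, which that record type inherits, are not used.
  \<open>Modules.module\<close> is the locale behind vector_space, not the one of HOL-Algebra.\<close>

definition qscale :: "rat \<Rightarrow> ('a \<Rightarrow>\<^sub>0 rat) \<Rightarrow> ('a \<Rightarrow>\<^sub>0 rat)" where
  "qscale c f = Poly_Mapping.map ((*) c) f"

definition rel_class :: "('a \<Rightarrow>\<^sub>0 rat) set \<Rightarrow> ('a \<Rightarrow>\<^sub>0 rat) \<Rightarrow> ('a \<Rightarrow>\<^sub>0 rat) set" where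
  "rel_class R f = {f + r | r. r \<in> Modules.module.span qscale R}"

definition presented_space ::
    "'a set \<Rightarrow> ('a \<Rightarrow>\<^sub>0 rat) set \<Rightarrow> (rat, ('a \<Rightarrow>\<^sub>0 rat) set) module" where
  "presented_space X R =
    \<lparr>carrier = rel_class R ` {f. Poly_Mapping.keys f \<subseteq> X},
     monoid.mult = undefined,
     one = undefined,
     zero = rel_class R 0,
     add = (\<lambda>A B. {f + g | f g. f \<in> A \<and> g \<in> B}),
     smult = (\<lambda>c A. \<Union>f\<in>A. rel_class R (qscale c f))\<rparr>"

definition linear_maps :: "(rat, 'a) module \<Rightarrow> (rat, 'b) module \<Rightarrow> ('a \<Rightarrow> 'b) set" where
  "linear_maps M N = {T \<in> carrier M \<rightarrow> carrier N.
     (\<forall>x\<in>carrier M. \<forall>y\<in>carrier M. T (x \<oplus>\<^bsub>M\<^esub> y) = T x \<oplus>\<^bsub>N\<^esub> T y) \<and>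
     (\<forall>c. \<forall>x\<in>carrier M. T (c \<odot>\<^bsub>M\<^esub> x) = c \<odot>\<^bsub>N\<^esub> T x)}"


section \<open>Tensor products over the rationals\<close>

definition tensor_rels :: "(rat, 'a) module \<Rightarrow> (rat, 'b) module \<Rightarrow> ('a \<times> 'b \<Rightarrow>\<^sub>0 rat) set" where
  "tensor_rels M N =
     {Poly_Mapping.single (x \<oplus>\<^bsub>M\<^esub> x', y) 1 - Poly_Mapping.single (x, y) 1 - Poly_Mapping.single (x', y) 1
        | x x' y. x \<in> carrier M \<and> x' \<in> carrier M \<and> y \<in> carrier N} \<union>
     {Poly_Mapping.single (x, y \<oplus>\<^bsub>N\<^esub> y') 1 - Poly_Mapping.single (x, y) 1 - Poly_Mapping.single (x, y') 1
        | x y y'. x \<in> carrier M \<and> y \<in> carrier N \<and> y' \<in> carrier N} \<union>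
     {Poly_Mapping.single (c \<odot>\<^bsub>M\<^esub> x, y) 1 - Poly_Mapping.single (x, y) c
        | c x y. x \<in> carrier M \<and> y \<in> carrier N} \<union>
     {Poly_Mapping.single (x, c \<odot>\<^bsub>N\<^esub> y) 1 - Poly_Mapping.single (x, y) c
        | c x y. x \<in> carrier M \<and> y \<in> carrier N}"

definition tensor_space ::
    "(rat, 'a) module \<Rightarrow> (rat, 'b) module \<Rightarrow> (rat, ('a \<times> 'b \<Rightarrow>\<^sub>0 rat) set) module" where
  "tensor_space M N = presented_space (carrier M \<times> carrier N) (tensor_rels M N)"

definition pure_tensor ::
    "(rat, 'a) module \<Rightarrow> (rat, 'b) module \<Rightarrow> 'a \<Rightarrow> 'b \<Rightarrow> ('a \<times> 'b \<Rightarrow>\<^sub>0 rat) set" where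
  "pure_tensor M N x y = rel_class (tensor_rels M N) (Poly_Mapping.single (x, y) 1)"


section \<open>The Steinberg module\<close>

text \<open>\<open>V\<close> is a finite-dimensional subspace of the vector space with scalar multiplication \<open>sc\<close>;
  vector_space.dim is 0 on infinite-dimensional subspaces, for which the definitions below are
  not meant.\<close>

definition apartment_tuples :: "('f::field \<Rightarrow> 'v::ab_group_add \<Rightarrow> 'v) \<Rightarrow> 'v set \<Rightarrow> 'v list set" where
  "apartment_tuples sc V = {vs. length vs = vector_space.dim sc V \<and> set vs \<subseteq> V - {0}}"

definition lin_indep_list :: "('f::field \<Rightarrow> 'v::ab_group_add \<Rightarrow> 'v) \<Rightarrow> 'v list \<Rightarrow> bool" where
  "lin_indep_list sc vs \<longleftrightarrow> distinct vs \<and> \<not> Modules.module.dependent sc (set vs)"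

definition omit :: "nat \<Rightarrow> 'a list \<Rightarrow> 'a list" where
  "omit i xs = take i xs @ drop (Suc i) xs"

definition steinberg_rels ::
    "('f::field \<Rightarrow> 'v::ab_group_add \<Rightarrow> 'v) \<Rightarrow> 'v set \<Rightarrow> ('v list \<Rightarrow>\<^sub>0 rat) set" where
  "steinberg_rels sc V =
     {Poly_Mapping.single vs 1 | vs. vs \<in> apartment_tuples sc V \<and> \<not> lin_indep_list sc vs} \<union>
     {Poly_Mapping.single (permute_list p vs) 1 - Poly_Mapping.single vs (of_int (sign p))
        | p vs. vs \<in> apartment_tuples sc V \<and> p permutes {..<length vs}} \<union>
     {Poly_Mapping.single (vs[i := sc c (vs ! i)]) 1 - Poly_Mapping.single vs 1
        | c i vs. vs \<in> apartment_tuples sc V \<and> i < length vs \<and> c \<noteq> 0} \<union>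
     {(\<Sum>i<length vs. Poly_Mapping.single (omit i vs) ((-1) ^ i))
        | vs. length vs = Suc (vector_space.dim sc V) \<and> set vs \<subseteq> V - {0}}"

definition St ::
    "('f::field \<Rightarrow> 'v::ab_group_add \<Rightarrow> 'v) \<Rightarrow> 'v set \<Rightarrow> (rat, ('v list \<Rightarrow>\<^sub>0 rat) set) module" where
  "St sc V = presented_space (apartment_tuples sc V) (steinberg_rels sc V)"

definition apartment ::
    "('f::field \<Rightarrow> 'v::ab_group_add \<Rightarrow> 'v) \<Rightarrow> 'v set \<Rightarrow> 'v list \<Rightarrow> ('v list \<Rightarrow>\<^sub>0 rat) set" where
  "apartment sc V vs = rel_class (steinberg_rels sc V) (Poly_Mapping.single vs 1)"

type_synonym 'v St2 = "(('v list \<Rightarrow>\<^sub>0 rat) set \<times> ('v list \<Rightarrow>\<^sub>0 rat) set \<Rightarrow>\<^sub>0 rat) set"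

definition St2 ::
    "('f::field \<Rightarrow> 'v::ab_group_add \<Rightarrow> 'v) \<Rightarrow> 'v set \<Rightarrow> (rat, 'v St2) module" where
  "St2 sc V = tensor_space (St sc V) (St sc V)"

definition apartment_tensor ::
    "('f::field \<Rightarrow> 'v::ab_group_add \<Rightarrow> 'v) \<Rightarrow> 'v set \<Rightarrow> 'v list \<Rightarrow> 'v list \<Rightarrow> 'v St2" where
  "apartment_tensor sc V vs ws =
     pure_tensor (St sc V) (St sc V) (apartment sc V vs) (apartment sc V ws)"


section \<open>Duality\<close>

text \<open>From here on the vector space \<open>V\<close> is a whole type \<open>'v\<close>. Its dual is a subspace of the
  function type \<open>'v \<Rightarrow> 'f\<close>, which carries the pointwise operations.\<close>

definition dual_scale :: "'f::field \<Rightarrow> ('v \<Rightarrow> 'f) \<Rightarrow> 'v \<Rightarrow> 'f" where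
  "dual_scale c \<phi> = (\<lambda>x. c * \<phi> x)"

definition dual_space :: "('f::field \<Rightarrow> 'v::ab_group_add \<Rightarrow> 'v) \<Rightarrow> ('v \<Rightarrow> 'f) set" where
  "dual_space sc = {\<phi>. Vector_Spaces.linear sc (*) \<phi>}"

text \<open>For lines \<open>P\<^sub>i\<close> generated by the vectors \<open>vs ! i\<close>, the following says that each line
  \<open>H\<^sub>i\<close> of the dual tuple is generated by the functional \<open>\<phi>s ! i\<close>, i.e. that the kernel of the
  latter is the hyperplane spanned by the other lines.\<close>

definition dual_tuple ::
    "('f::field \<Rightarrow> 'v::ab_group_add \<Rightarrow> 'v) \<Rightarrow> 'v list \<Rightarrow> ('v \<Rightarrow> 'f) list \<Rightarrow> bool" where
  "dual_tuple sc vs \<phi>s \<longleftrightarrow> length \<phi>s = length vs \<and>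
     (\<forall>i<length vs. \<phi>s ! i \<in> dual_space sc \<and>
        {x. (\<phi>s ! i) x = 0} = Modules.module.span sc (set (omit i vs)))"

text \<open>The conditions determine the map on the carrier, because the apartments of spanning tuples
  generate \<open>St\<close>; its values outside the carrier are irrelevant.\<close>

definition duality :: "('f::field \<Rightarrow> 'v::ab_group_add \<Rightarrow> 'v) \<Rightarrow> 'v St2 \<Rightarrow> ('v \<Rightarrow> 'f) St2" where
  "duality sc = (SOME D.
     D \<in> linear_maps (St2 sc UNIV) (St2 dual_scale (dual_space sc)) \<and>
     (\<forall>vs ws \<phi>s \<psi>s.
        vs \<in> apartment_tuples sc UNIV \<and> Modules.module.span sc (set vs) = UNIV \<and>
        ws \<in> apartment_tuples sc UNIV \<and> Modules.module.span sc (set ws) = UNIV \<and>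
        dual_tuple sc vs \<phi>s \<and> dual_tuple sc ws \<psi>s \<longrightarrow>
        D (apartment_tensor sc UNIV vs ws)
          = apartment_tensor dual_scale (dual_space sc) \<psi>s \<phi>s))"


section \<open>Steinberg polylogarithms and iterated integrals\<close>

text \<open>The sequence \<open>v\<^sub>1, \<dots>, v\<^sub>d\<close> is given by a function on \<open>nat\<close>, of which only the values on
  \<open>{1..d}\<close> matter. The list \<open>rev [1..<Suc d]\<close> is \<open>d, d - 1, \<dots>, 1\<close>.\<close>

definition St_L ::
    "('f::field \<Rightarrow> 'v::ab_group_add \<Rightarrow> 'v) \<Rightarrow> 'v set \<Rightarrow> nat \<Rightarrow> (nat \<Rightarrow> 'v) \<Rightarrow> 'v St2" where
  "St_L sc V d v = apartment_tensor sc V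
     (map (\<lambda>i. \<Sum>j=i..d. v j) (rev [1..<Suc d]))
     (map v (rev [1..<Suc d]))"

definition St_I ::
    "('f::field \<Rightarrow> 'v::ab_group_add \<Rightarrow> 'v) \<Rightarrow> 'v set \<Rightarrow> nat \<Rightarrow> (nat \<Rightarrow> 'v) \<Rightarrow> 'v St2" where
  "St_I sc V d v = (-1) ^ d \<odot>\<^bsub>St2 sc V\<^esub> apartment_tensor sc V
     (map v (rev [1..<Suc d]))
     (map (\<lambda>i. if i = d then v d else v i - v (Suc i)) (rev [1..<Suc d]))"

end

theory Submission
  imports Defs
begin

text \<open>The point is that the duality map is well defined; then both identities are read off from the
  dual bases of the tuples involved, up to reversing both tensor factors, which multiplies each by
  the same sign.

  A vector of a presented space vanishes iff all functionals that kill the relations vanish on it,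
  so it suffices to show that a Steinberg symbol, i.e. a function on tuples obeying the Steinberg
  relations, of the dual space pulls back to a Steinberg symbol under passing to the dual tuple.
  For the \<open>(d + 1)\<close>-term relation one must show that, for distinct points \<open>x\<^sub>0, \<dots>, x\<^sub>k\<close>, the
  alternating sum over \<open>i\<close> of the symbols of the stars \<open>(x\<^sub>j - x\<^sub>i)\<^sub>j\<close> is zero. Applying the
  three-term relation to the edges of the triangles \<open>x\<^sub>0, x\<^sub>1, x\<^sub>i\<close> expresses this sum as the difference
  of the sums for \<open>x\<^sub>0, x\<^sub>2, \<dots>, x\<^sub>k\<close> and \<open>x\<^sub>1, x\<^sub>2, \<dots>, x\<^sub>k\<close>, both with the edge
  \<open>x\<^sub>1 - x\<^sub>0\<close> prepended, and induction applies.\<close>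


section \<open>Presented rational vector spaces\<close>

lemma lookup_qscale [simp]: "Poly_Mapping.lookup (qscale c f) k = c * Poly_Mapping.lookup f k"
  by (simp add: qscale_def Poly_Mapping.map.rep_eq when_def)

lemma qscale_single [simp]: "qscale c (Poly_Mapping.single k a) = Poly_Mapping.single k (c * a)"
  by (simp add: qscale_def)

lemma vector_space_qscale: "vector_space qscale"
  by unfold_locales (auto intro!: poly_mapping_eqI simp: lookup_add algebra_simps)

lemma vector_space_mult: "vector_space ((*) :: 'f::field \<Rightarrow> 'f \<Rightarrow> 'f)"
  by unfold_locales (auto simp: algebra_simps)

interpretation qs: vector_space qscale
  by (rule vector_space_qscale)

interpretation qs_rat: vector_space_pair qscale "(*) :: rat \<Rightarrow> rat \<Rightarrow> rat"
  by (simp add: vector_space_pair_def vector_space_qscale vector_space_mult)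

lemma keys_qscale_subset: "Poly_Mapping.keys (qscale c f) \<subseteq> Poly_Mapping.keys f"
  by (auto simp: in_keys_iff)

text \<open>If \<open>x\<close> were outside the span, a basis of the span of \<open>R\<close> could
  be enlarged by \<open>x\<close>, and some functional would be 1 at \<open>x\<close> and 0 on
  \<open>R\<close>. The criterion turns statements about classes into statements about
  rational-valued functions.\<close>

lemma in_span_if_functionals_vanish:
  assumes "\<And>l. Vector_Spaces.linear qscale (*) l \<Longrightarrow> (\<And>r. r \<in> R \<Longrightarrow> l r = (0::rat)) \<Longrightarrow> l x = 0"
  shows "x \<in> qs.span R"
proof (rule ccontr)
  assume x: "x \<notin> qs.span R"
  obtain B where B: "B \<subseteq> R" "qs.independent B" "R \<subseteq> qs.span B"
    using qs.maximal_independent_subset by blast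
  have xB: "x \<notin> qs.span B"
    using x B(1) qs.span_mono by blast
  then have ind: "qs.independent (insert x B)"
    using B(2) by (simp add: qs.independent_insert)
  obtain l where l: "Vector_Spaces.linear qscale (*) l"
    and lv: "\<forall>y\<in>insert x B. l y = (if y = x then 1 else 0 :: rat)"
    using qs_rat.linear_independent_extend[OF ind, of "\<lambda>y. if y = x then 1 else 0"] by blast
  have "l y = 0" if "y \<in> B" for y
    using lv that xB qs.span_base by force
  then have "l r = 0" if "r \<in> R" for r
    using qs_rat.linear_eq_0_on_span[OF l] B(3) that by blast
  then have "l x = 0"
    using assms[OF l] by blast
  then show False
    using lv by simp
qed

section \<open>Linear extension of maps given on generators\<close>

definition free_ext :: "('a \<Rightarrow> ('b \<Rightarrow>\<^sub>0 rat)) \<Rightarrow> ('a \<Rightarrow>\<^sub>0 rat) \<Rightarrow> ('b \<Rightarrow>\<^sub>0 rat)" where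
  "free_ext g f = (\<Sum>k\<in>Poly_Mapping.keys f. qscale (Poly_Mapping.lookup f k) (g k))"

lemma free_ext_eq_sum:
  assumes "finite K" "Poly_Mapping.keys f \<subseteq> K"
  shows "free_ext g f = (\<Sum>k\<in>K. qscale (Poly_Mapping.lookup f k) (g k))"
  unfolding free_ext_def
  by (rule sum.mono_neutral_left) (use assms in \<open>auto simp: in_keys_iff\<close>)

lemma linear_free_ext: "Vector_Spaces.linear qscale qscale (free_ext g)"
proof (rule Vector_Spaces.linear_iff[THEN iffD2], intro conjI allI)
  fix f h :: "'a \<Rightarrow>\<^sub>0 rat" and c
  let ?K = "Poly_Mapping.keys f \<union> Poly_Mapping.keys h"
  show "free_ext g (f + h) = free_ext g f + free_ext g h"
    using keys_add[of f h]
    by (simp add: free_ext_eq_sum[of ?K] lookup_add qs.scale_left_distrib sum.distrib)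
  show "free_ext g (qscale c f) = qscale c (free_ext g f)"
    using keys_qscale_subset[of c f]
    by (simp add: free_ext_eq_sum[of "Poly_Mapping.keys f"] qs.scale_sum_right)
qed (auto simp: vector_space_qscale)

lemma free_ext_single [simp]: "free_ext g (Poly_Mapping.single k c) = qscale c (g k)"
  by (simp add: free_ext_eq_sum[of "{k}"])

lemma keys_free_ext:
  assumes "\<And>k. k \<in> Poly_Mapping.keys f \<Longrightarrow> Poly_Mapping.keys (g k) \<subseteq> Y"
  shows "Poly_Mapping.keys (free_ext g f) \<subseteq> Y"
  unfolding free_ext_def
  using keys_sum[of "\<lambda>k. qscale (Poly_Mapping.lookup f k) (g k)" "Poly_Mapping.keys f"]
    keys_qscale_subset assms by fastforce

section \<open>Classes modulo relations, and maps induced on them\<close>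

lemma mem_rel_class: "h \<in> rel_class R f \<longleftrightarrow> h - f \<in> qs.span R"
proof
  assume "h - f \<in> qs.span R"
  then show "h \<in> rel_class R f"
    unfolding rel_class_def by (auto intro!: exI[of _ "h - f"])
qed (auto simp: rel_class_def)

lemma rel_class_eq_iff: "rel_class R f = rel_class R g \<longleftrightarrow> f - g \<in> qs.span R"
proof
  assume "rel_class R f = rel_class R g"
  then show "f - g \<in> qs.span R"
    using mem_rel_class[of f R f] mem_rel_class[of f R g] by (simp add: qs.span_zero)
next
  assume fg: "f - g \<in> qs.span R"
  have "h - f \<in> qs.span R \<longleftrightarrow> h - g \<in> qs.span R" for h
    using qs.span_add_eq[OF fg, of "h - f"] by simp
  then show "rel_class R f = rel_class R g"
    by (auto simp: mem_rel_class)
qed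

lemma presented_space_add [simp]:
  "rel_class R f \<oplus>\<^bsub>presented_space X R\<^esub> rel_class R g = rel_class R (f + g)"
proof -
  have "{a + b |a b. a \<in> rel_class R f \<and> b \<in> rel_class R g} = rel_class R (f + g)"
  proof (intro equalityI subsetI)
    fix h assume "h \<in> {a + b |a b. a \<in> rel_class R f \<and> b \<in> rel_class R g}"
    then show "h \<in> rel_class R (f + g)"
      by (auto simp: mem_rel_class add_diff_add qs.span_add)
  next
    fix h assume "h \<in> rel_class R (f + g)"
    then have "h - g \<in> rel_class R f" "h = (h - g) + g" "g \<in> rel_class R g"
      by (auto simp: mem_rel_class qs.span_zero algebra_simps)
    then show "h \<in> {a + b |a b. a \<in> rel_class R f \<and> b \<in> rel_class R g}"
      by blast
  qed
  then show ?thesis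
    by (simp add: presented_space_def)
qed

lemma presented_space_smult [simp]:
  "c \<odot>\<^bsub>presented_space X R\<^esub> rel_class R f = rel_class R (qscale c f)"
proof -
  have "rel_class R (qscale c g) = rel_class R (qscale c f)" if "g \<in> rel_class R f" for g
    using that by (simp add: mem_rel_class rel_class_eq_iff qs.span_scale
        flip: qs.scale_right_diff_distrib)
  moreover have "f \<in> rel_class R f"
    by (simp add: mem_rel_class qs.span_zero)
  ultimately have "(\<Union>g\<in>rel_class R f. rel_class R (qscale c g)) = rel_class R (qscale c f)"
    by blast
  then show ?thesis
    by (simp add: presented_space_def)
qed

lemma carrier_presented_space:
  "carrier (presented_space X R) = rel_class R ` {f. Poly_Mapping.keys f \<subseteq> X}"
  by (simp add: presented_space_def)

text \<open>The union over all representatives avoids choosing one: if \<open>l\<close> sends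
  relations into the span of \<open>R'\<close>, the classes \<open>rel_class R' (l f)\<close>
  coincide for all \<open>f\<close> in one class.\<close>

definition induced_map ::
    "('b \<Rightarrow>\<^sub>0 rat) set \<Rightarrow> (('a \<Rightarrow>\<^sub>0 rat) \<Rightarrow> ('b \<Rightarrow>\<^sub>0 rat)) \<Rightarrow> ('a \<Rightarrow>\<^sub>0 rat) set \<Rightarrow> ('b \<Rightarrow>\<^sub>0 rat) set" where
  "induced_map R' l A = (\<Union>f\<in>A. rel_class R' (l f))"

lemma induced_map_rel_class:
  assumes l: "Vector_Spaces.linear qscale qscale l"
    and R: "\<And>r. r \<in> R \<Longrightarrow> l r \<in> qs.span R'"
  shows "induced_map R' l (rel_class R f) = rel_class R' (l f)"
proof -
  interpret l: Vector_Spaces.linear qscale qscale l by (rule l)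
  have "l r \<in> qs.span R'" if "r \<in> qs.span R" for r
    using that by (rule qs.span_induct) (auto simp: qs.subspace_def l.zero l.add l.scale
        qs.span_add qs.span_scale qs.span_zero R)
  then have "rel_class R' (l g) = rel_class R' (l f)" if "g \<in> rel_class R f" for g
    using that by (simp add: mem_rel_class rel_class_eq_iff flip: l.diff)
  moreover have "f \<in> rel_class R f"
    by (simp add: mem_rel_class qs.span_zero)
  ultimately show ?thesis
    unfolding induced_map_def by blast
qed

lemma induced_map_linear:
  assumes l: "Vector_Spaces.linear qscale qscale l"
    and R: "\<And>r. r \<in> R \<Longrightarrow> l r \<in> qs.span R'"
    and X: "\<And>f. Poly_Mapping.keys f \<subseteq> X \<Longrightarrow> Poly_Mapping.keys (l f) \<subseteq> Y"
  shows "induced_map R' l \<in> linear_maps (presented_space X R) (presented_space Y R')"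
proof -
  interpret l: Vector_Spaces.linear qscale qscale l by (rule l)
  note ev = induced_map_rel_class[OF l R]
  show ?thesis
    unfolding linear_maps_def carrier_presented_space
    by (auto simp: ev l.add l.scale X)
qed


section \<open>Tensor products\<close>

lemma tensor_smult [simp]:
  assumes "x \<in> carrier M" "y \<in> carrier N"
  shows "pure_tensor M N (c \<odot>\<^bsub>M\<^esub> x) y = c \<odot>\<^bsub>tensor_space M N\<^esub> pure_tensor M N x y"
    and "pure_tensor M N x (c \<odot>\<^bsub>N\<^esub> y) = c \<odot>\<^bsub>tensor_space M N\<^esub> pure_tensor M N x y"
  unfolding pure_tensor_def tensor_space_def presented_space_smult rel_class_eq_iff
  using assms by (auto intro!: qs.span_base simp: tensor_rels_def)

lemma pure_tensor_carrier:
  assumes "x \<in> carrier M" "y \<in> carrier N"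
  shows "pure_tensor M N x y \<in> carrier (tensor_space M N)"
  unfolding pure_tensor_def tensor_space_def carrier_presented_space
  by (rule imageI) (use assms in auto)

text \<open>The tensor square of \<open>t\<close> followed by the exchange of the factors, which is
  the shape of the duality map.\<close>

definition swap_tensor ::
    "(rat, 'b) module \<Rightarrow> ('a \<Rightarrow> 'b) \<Rightarrow> ('a \<times> 'a \<Rightarrow>\<^sub>0 rat) set \<Rightarrow> ('b \<times> 'b \<Rightarrow>\<^sub>0 rat) set" where
  "swap_tensor N t =
     induced_map (tensor_rels N N) (free_ext (\<lambda>(x, y). Poly_Mapping.single (t y, t x) 1))"

lemma
  assumes t: "t \<in> linear_maps M N"
  shows swap_tensor_linear: "swap_tensor N t \<in> linear_maps (tensor_space M M) (tensor_space N N)"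
    and swap_tensor_pure: "swap_tensor N t (pure_tensor M M x y) = pure_tensor N N (t y) (t x)"
proof -
  let ?g = "\<lambda>(x, y). Poly_Mapping.single (t y, t x) (1::rat)"
  interpret l: Vector_Spaces.linear qscale qscale "free_ext ?g" by (rule linear_free_ext)
  have t_in: "t x \<in> carrier N" if "x \<in> carrier M" for x
    using t that by (auto simp: linear_maps_def)
  have t_add: "t (x \<oplus>\<^bsub>M\<^esub> y) = t x \<oplus>\<^bsub>N\<^esub> t y" if "x \<in> carrier M" "y \<in> carrier M" for x y
    using t that by (auto simp: linear_maps_def)
  have t_smult: "t (c \<odot>\<^bsub>M\<^esub> x) = c \<odot>\<^bsub>N\<^esub> t x" if "x \<in> carrier M" for c x
    using t that by (auto simp: linear_maps_def)
  have R: "free_ext ?g r \<in> qs.span (tensor_rels N N)" if "r \<in> tensor_rels M M" for r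
  proof (rule qs.span_base)
    from that consider
        (1) x x' y where "r = Poly_Mapping.single (x \<oplus>\<^bsub>M\<^esub> x', y) 1 - Poly_Mapping.single (x, y) 1
            - Poly_Mapping.single (x', y) 1"
          "x \<in> carrier M" "x' \<in> carrier M" "y \<in> carrier M"
      | (2) x y y' where "r = Poly_Mapping.single (x, y \<oplus>\<^bsub>M\<^esub> y') 1 - Poly_Mapping.single (x, y) 1
            - Poly_Mapping.single (x, y') 1"
          "x \<in> carrier M" "y \<in> carrier M" "y' \<in> carrier M"
      | (3) c x y where "r = Poly_Mapping.single (c \<odot>\<^bsub>M\<^esub> x, y) 1 - Poly_Mapping.single (x, y) c"
          "x \<in> carrier M" "y \<in> carrier M"
      | (4) c x y where "r = Poly_Mapping.single (x, c \<odot>\<^bsub>M\<^esub> y) 1 - Poly_Mapping.single (x, y) c"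
          "x \<in> carrier M" "y \<in> carrier M"
      unfolding tensor_rels_def Un_iff mem_Collect_eq by blast
    then show "free_ext ?g r \<in> tensor_rels N N"
    proof cases
      case 1
      then have "free_ext ?g r = Poly_Mapping.single (t y, t x \<oplus>\<^bsub>N\<^esub> t x') 1
          - Poly_Mapping.single (t y, t x) 1 - Poly_Mapping.single (t y, t x') 1"
        by (simp add: l.diff t_add)
      with 1 show ?thesis
        unfolding tensor_rels_def by (blast intro: t_in)
    next
      case 2
      then have "free_ext ?g r = Poly_Mapping.single (t y \<oplus>\<^bsub>N\<^esub> t y', t x) 1
          - Poly_Mapping.single (t y, t x) 1 - Poly_Mapping.single (t y', t x) 1"
        by (simp add: l.diff t_add)
      with 2 show ?thesis
        unfolding tensor_rels_def by (blast intro: t_in)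
    next
      case 3
      then have "free_ext ?g r = Poly_Mapping.single (t y, c \<odot>\<^bsub>N\<^esub> t x) 1
          - Poly_Mapping.single (t y, t x) c"
        by (simp add: l.diff t_smult)
      with 3 show ?thesis
        unfolding tensor_rels_def by (blast intro: t_in)
    next
      case 4
      then have "free_ext ?g r = Poly_Mapping.single (c \<odot>\<^bsub>N\<^esub> t y, t x) 1
          - Poly_Mapping.single (t y, t x) c"
        by (simp add: l.diff t_smult)
      with 4 show ?thesis
        unfolding tensor_rels_def by (blast intro: t_in)
    qed
  qed
  show "swap_tensor N t \<in> linear_maps (tensor_space M M) (tensor_space N N)"
    unfolding swap_tensor_def tensor_space_def
  proof (rule induced_map_linear[OF linear_free_ext R])
    fix f :: "'a \<times> 'a \<Rightarrow>\<^sub>0 rat"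
    assume "Poly_Mapping.keys f \<subseteq> carrier M \<times> carrier M"
    then show "Poly_Mapping.keys (free_ext ?g f) \<subseteq> carrier N \<times> carrier N"
      by (intro keys_free_ext) (auto simp: t_in)
  qed
  show "swap_tensor N t (pure_tensor M M x y) = pure_tensor N N (t y) (t x)"
    unfolding swap_tensor_def pure_tensor_def
    by (subst induced_map_rel_class[OF linear_free_ext, where R = "tensor_rels M M"]) (auto intro: R)
qed


section \<open>Omitting list entries\<close>

lemma omit_append:
  "omit i (xs @ ys) = (if i < length xs then omit i xs @ ys else xs @ omit (i - length xs) ys)"
  by (auto simp: omit_def Suc_diff_le not_less)

lemma omit_0 [simp]: "omit 0 (x # xs) = xs"
  by (simp add: omit_def)

lemma omit_Suc [simp]: "omit (Suc i) (x # xs) = x # omit i xs"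
  by (simp add: omit_def)

lemma omit_map: "omit i (map f xs) = map f (omit i xs)"
  by (simp add: omit_def take_map drop_map)

lemma length_omit [simp]: "i < length xs \<Longrightarrow> length (omit i xs) = length xs - 1"
  by (simp add: omit_def)

lemma set_omit_subset: "set (omit i xs) \<subseteq> set xs"
  by (auto simp: omit_def dest: in_set_takeD in_set_dropD)

lemma set_omit_distinct: "distinct xs \<Longrightarrow> i < length xs \<Longrightarrow> set (omit i xs) = set xs - {xs ! i}"
proof (induction xs arbitrary: i)
  case (Cons x xs)
  then show ?case
    by (cases i) auto
qed simp

text \<open>\<open>sorted_wrt\<close> compares an entry with the later ones; symmetry covers the
  earlier ones.\<close>

lemma sorted_wrt_omit:
  assumes "sorted_wrt P xs" "symp P" "i < length xs" "y \<in> set (omit i xs)"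
  shows "P (xs ! i) y"
  using assms
proof (induction xs arbitrary: i)
  case (Cons x xs)
  then show ?case
    by (cases i) (auto dest: sympD)
qed simp

text \<open>\<open>F\<close> also receives the omitted entry, because in the star relation the
  omitted point is the one from which the edges leave.\<close>

definition omit_sum :: "('a \<Rightarrow> 'a list \<Rightarrow> rat) \<Rightarrow> 'a list \<Rightarrow> rat" where
  "omit_sum F xs = (\<Sum>i<length xs. (-1) ^ i * F (xs ! i) (omit i xs))"

lemma omit_sum_Nil [simp]: "omit_sum F [] = 0"
  by (simp add: omit_sum_def)

text \<open>Splitting off the first entry shifts all other positions by one, whence the minus
  sign.\<close>

lemma omit_sum_Cons: "omit_sum F (x # xs) = F x xs - omit_sum (\<lambda>y ys. F y (x # ys)) xs"
  unfolding omit_sum_def length_Cons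
  by (subst sum.lessThan_Suc_shift) (simp add: sum_negf)

lemma omit_sum_cong:
  assumes "\<And>i. i < length xs \<Longrightarrow> F (xs ! i) (omit i xs) = G (xs ! i) (omit i xs)"
  shows "omit_sum F xs = omit_sum G xs"
  unfolding omit_sum_def using assms by (intro sum.cong) auto

lemma omit_sum_diff: "omit_sum (\<lambda>x xs. F x xs - G x xs) xs = omit_sum F xs - omit_sum G xs"
  by (simp add: omit_sum_def sum_subtractf algebra_simps)

lemma omit_sum_0:
  assumes "\<And>i. i < length xs \<Longrightarrow> F (xs ! i) (omit i xs) = 0"
  shows "omit_sum F xs = 0"
  using assms by (simp add: omit_sum_def)


section \<open>Steinberg symbols\<close>

text \<open>Such functions are the values on generators of the functionals killing the Steinberg
  relations, by \<open>kills_steinberg_rels\<close> and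
  \<open>steinberg_symbol_functional\<close>.\<close>

locale steinberg_symbol = vector_space scale
  for scale :: "'f::field \<Rightarrow> 'v::ab_group_add \<Rightarrow> 'v" (infixr "*s" 75) +
  fixes V :: "'v set" and s :: "'v list \<Rightarrow> rat"
  assumes subspace_V: "subspace V"
    and dependent_0: "vs \<in> apartment_tuples (*s) V \<Longrightarrow> \<not> lin_indep_list (*s) vs \<Longrightarrow> s vs = 0"
    and permute: "vs \<in> apartment_tuples (*s) V \<Longrightarrow> p permutes {..<length vs} \<Longrightarrow>
      s (permute_list p vs) = of_int (sign p) * s vs"
    and rescale: "vs \<in> apartment_tuples (*s) V \<Longrightarrow> i < length vs \<Longrightarrow> c \<noteq> 0 \<Longrightarrow>
      s (vs[i := c *s (vs ! i)]) = s vs"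
    and cocycle: "length vs = Suc (dim V) \<Longrightarrow> set vs \<subseteq> V - {0} \<Longrightarrow>
      (\<Sum>i<length vs. (-1) ^ i * s (omit i vs)) = 0"

text \<open>A list with repetitions is not independent anyway, so the three vectors have to be
  distinct only when \<open>ps\<close> is.\<close>

lemma (in vector_space) not_lin_indep_list:
  assumes rel: "a *s u + b *s v + c *s w = 0" and nz: "a \<noteq> 0 \<or> b \<noteq> 0 \<or> c \<noteq> 0"
    and ps: "distinct ps \<Longrightarrow> distinct [u, v, w]" "{u, v, w} \<subseteq> set ps"
  shows "\<not> lin_indep_list (*s) ps"
proof
  assume "lin_indep_list (*s) ps"
  then have d: "distinct [u, v, w]" and "independent (set ps)"
    using ps by (auto simp: lin_indep_list_def)
  then have ind: "independent {u, v, w}"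
    using ps(2) dependent_mono by blast
  \<comment> \<open>Since \<open>u\<close>, \<open>v\<close>, \<open>w\<close> are distinct, the
    nested conditionals give each vector its own coefficient.\<close>
  let ?f = "\<lambda>x. if x = u then a else if x = v then b else c"
  have "(\<Sum>x\<in>{u, v, w}. ?f x *s x) = 0"
    using d rel by (auto simp: add.assoc)
  then have "?f x = 0" if "x \<in> {u, v, w}" for x
    using independentD[OF ind, of "{u, v, w}" ?f x] that by blast
  from this[of u] this[of v] this[of w] show False
    using nz d by (auto split: if_splits)
qed

context steinberg_symbol
begin

section \<open>Elementary consequences of the symbol relations\<close>

lemma apartment_tuples_iff:
  "vs \<in> apartment_tuples (*s) V \<longleftrightarrow> length vs = dim V \<and> set vs \<subseteq> V - {0}"
  by (simp add: apartment_tuples_def)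

lemma rescale_at:
  assumes "A @ u # B \<in> apartment_tuples (*s) V" "c \<noteq> 0"
  shows "s (A @ c *s u # B) = s (A @ u # B)"
  using rescale[OF assms(1) _ assms(2), of "length A"] by (simp add: list_update_append)

lemma swap_adjacent:
  assumes "A @ u # v # B \<in> apartment_tuples (*s) V"
  shows "s (A @ v # u # B) = - s (A @ u # v # B)"
proof -
  let ?p = "transpose (length A) (Suc (length A))"
  let ?vs = "A @ u # v # B"
  have p: "?p permutes {..<length ?vs}"
    by (rule permutes_swap_id) auto
  have "permute_list ?p ?vs = A @ v # u # B"
  proof (rule nth_equalityI)
    fix i assume i: "i < length (permute_list ?p ?vs)"
    \<comment> \<open>The last alternative expresses \<open>i\<close> by its distance past the
      swapped pair, so that both lists can be evaluated there.\<close>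
    have "i < length A \<or> i = length A \<or> i = Suc (length A) \<or>
        i = Suc (Suc (length A + (i - length A - 2)))"
      by arith
    then consider "i < length A" | "i = length A" | "i = Suc (length A)"
      | k where "i = Suc (Suc (length A + k))"
      by blast
    then show "permute_list ?p ?vs ! i = (A @ v # u # B) ! i"
      using i by cases (simp_all add: permute_list_nth[OF p] nth_append transpose_def)
  qed simp
  then show ?thesis
    using permute[OF assms p] by (simp add: sign_swap_id)
qed

text \<open>In the relation for \<open>A @ u # v # w # B\<close>, omitting an entry outside the
  triple leaves a dependent tuple, so only three terms survive.\<close>

lemma three_term:
  assumes rel: "a *s u + b *s v + c *s w = 0" and nz: "a \<noteq> 0 \<or> b \<noteq> 0 \<or> c \<noteq> 0"
    and uvw: "{u, v, w} \<subseteq> V - {0}" and AB: "set A \<union> set B \<subseteq> V - {0}"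
    and len: "length A + 2 + length B = dim V"
  shows "s (A @ u # v # B) = s (A @ u # w # B) - s (A @ v # w # B)"
proof -
  let ?vs = "A @ u # v # w # B" and ?n = "length A"
  have vs: "length ?vs = Suc (dim V)" "set ?vs \<subseteq> V - {0}"
    using uvw AB len by auto
  have zero: "s (omit i ?vs) = 0" if i: "i < length ?vs" "i \<notin> {?n, Suc ?n, Suc (Suc ?n)}" for i
  proof (rule dependent_0)
    show "omit i ?vs \<in> apartment_tuples (*s) V"
      using vs i set_omit_subset[of i ?vs] by (simp add: apartment_tuples_iff) blast
    show "\<not> lin_indep_list (*s) (omit i ?vs)"
    proof (cases "i < ?n")
      case True
      then show ?thesis
        by (intro not_lin_indep_list[OF rel nz]) (auto simp: omit_append)
    next
      case False
      \<comment> \<open>The position lies behind the triple; counting past it in successors lets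
        \<open>omit\<close> compute.\<close>
      with i have "i - ?n = Suc (Suc (Suc (i - ?n - 3)))"
        by auto
      then obtain k where k: "i - ?n = Suc (Suc (Suc k))"
        by blast
      show ?thesis
        by (rule not_lin_indep_list[OF rel nz]) (use False in \<open>auto simp: omit_append k\<close>)
    qed
  qed
  have "0 = (\<Sum>i<length ?vs. (-1) ^ i * s (omit i ?vs))"
    using cocycle[OF vs] by simp
  also have "\<dots> = (\<Sum>i\<in>{?n, Suc ?n, Suc (Suc ?n)}. (-1) ^ i * s (omit i ?vs))"
    by (rule sum.mono_neutral_right) (auto simp: zero)
  also have "\<dots> = (-1) ^ ?n * (s (A @ v # w # B) - s (A @ u # w # B) + s (A @ u # v # B))"
    by (simp add: omit_append algebra_simps numeral_2_eq_2)
  finally show ?thesis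
    by simp
qed

text \<open>One entry is rescaled at a time; the induction moves it into the prefix
  \<open>A\<close>.\<close>

lemma rescale_all:
  assumes "list_all2 (\<lambda>u v. \<exists>c. c \<noteq> 0 \<and> v = c *s u) us vs"
    "length A + length us = dim V" "set A \<union> set us \<subseteq> V - {0}"
  shows "s (A @ vs) = s (A @ us)"
  using assms
proof (induction us vs arbitrary: A rule: list_all2_induct)
  case (Cons u us v vs)
  then obtain c where c: "c \<noteq> 0" "v = c *s u"
    by blast
  have "v \<in> V - {0}"
    using c Cons.prems subspace_V by (auto simp: subspace_scale)
  then have "s ((A @ [v]) @ vs) = s ((A @ [v]) @ us)"
    using Cons.prems by (intro Cons.IH) auto
  also have "\<dots> = s (A @ u # us)"
    using rescale_at[of A u us c] c Cons.prems by (simp add: apartment_tuples_iff)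
  finally show ?case
    by simp
qed simp


subsection \<open>The star relation\<close>

text \<open>An entry \<open>(a, \<phi>)\<close> stands for the point \<open>\<phi> / a\<close>, which is at infinity if \<open>a = 0\<close>, and
  \<open>edge\<close> is the direction of the line through two such points. \<open>star\<close> is the alternating sum over
  all finite points of the symbol of the edges from that point to all others.\<close>

definition edge :: "'f \<times> 'v \<Rightarrow> 'f \<times> 'v \<Rightarrow> 'v" where
  "edge p q = fst p *s snd q - fst q *s snd p"

definition star :: "'v list \<Rightarrow> ('f \<times> 'v) list \<Rightarrow> rat" where
  "star A = omit_sum (\<lambda>p M. if fst p = 0 then 0 else s (A @ map (edge p) M))"

text \<open>Distinctness of the two points. Two points at infinity are exempt: the edge between them
  is always 0 and never occurs in \<open>star\<close>.\<close>

definition edge_ok :: "'f \<times> 'v \<Rightarrow> 'f \<times> 'v \<Rightarrow> bool" where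
  "edge_ok p q \<longleftrightarrow> fst p \<noteq> 0 \<or> fst q \<noteq> 0 \<longrightarrow> edge p q \<noteq> 0"

lemma edge_swap: "edge q p = - edge p q"
  by (simp add: edge_def)

lemma symp_edge_ok: "symp edge_ok"
  by (auto simp: symp_def edge_ok_def edge_def)

lemma edge_in_V: "snd p \<in> V \<Longrightarrow> snd q \<in> V \<Longrightarrow> edge p q \<in> V"
  unfolding edge_def by (intro subspace_diff subspace_scale subspace_V)

text \<open>The sides of the triangle \<open>p\<close>, \<open>q\<close>, \<open>r\<close> are
  linearly related; up to orientation, each coefficient is the first coordinate of the opposite
  vertex. This is the input for \<open>three_term\<close>.\<close>

lemma edge_relation: "fst q *s edge r p + (- fst p) *s edge r q + fst r *s edge p q = 0"
  by (simp add: edge_def scale_right_diff_distrib mult.commute)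

lemma edges_subset:
  assumes "fst p \<noteq> 0" "snd p \<in> V" "snd ` set M \<subseteq> V" "\<And>q. q \<in> set M \<Longrightarrow> edge_ok p q"
  shows "set (map (edge p) M) \<subseteq> V - {0}"
  using assms by (auto simp: edge_ok_def intro!: edge_in_V)

text \<open>The terms of \<open>p\<close> and \<open>q\<close> contain \<open>edge p q\<close>
  already, up to sign. In the term of any other finite \<open>r\<close>, the three-term relation for
  the triangle \<open>p\<close>, \<open>q\<close>, \<open>r\<close> brings in this edge, and a swap
  moves it to the front.\<close>

lemma star_Cons_Cons:
  assumes p: "fst p \<noteq> 0"
    and len: "length A + Suc (Suc (length L)) = Suc (dim V)" and A: "set A \<subseteq> V - {0}"
    and V: "snd ` set (p # q # L) \<subseteq> V" and ok: "sorted_wrt edge_ok (p # q # L)"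
  shows "star A (p # q # L) = star (A @ [edge p q]) (p # L) - star (A @ [edge p q]) (q # L)"
proof -
  let ?e = "edge p q"
  have e: "?e \<in> V - {0}"
    using p V ok by (auto simp: edge_ok_def intro: edge_in_V)
  \<comment> \<open>Seen from \<open>q\<close>, the edge to \<open>p\<close> is \<open>- ?e\<close>,
    and the scalar -1 does not affect the symbol.\<close>
  have head: "s (A @ edge q p # map (edge q) L) = s (A @ ?e # map (edge q) L)" if "fst q \<noteq> 0"
  proof -
    have "set (map (edge q) L) \<subseteq> V - {0}"
      using that V ok by (intro edges_subset) auto
    then show ?thesis
      using rescale_at[of A ?e "map (edge q) L" "-1"] e A len
      by (simp add: apartment_tuples_iff edge_swap[of q p])
  qed
  have tail: "(if fst r = 0 then 0 else s (A @ edge r p # edge r q # map (edge r) M)) =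
      (if fst r = 0 then 0 else s (A @ ?e # edge r q # map (edge r) M)) -
      (if fst r = 0 then 0 else s (A @ ?e # edge r p # map (edge r) M))"
    if i: "i < length L" "r = L ! i" "M = omit i L" for i r M
  proof (cases "fst r = 0")
    case False
    have r: "r \<in> set L" and M: "set M \<subseteq> set L" and lenM: "Suc (length M) = length L"
      using i set_omit_subset[of i L] by auto
    have okM: "edge_ok r t" if "t \<in> set M" for t
      using sorted_wrt_omit[of edge_ok L i t] ok that i symp_edge_ok by auto
    have okr: "edge_ok r p" "edge_ok r q"
      using ok r symp_edge_ok by (auto dest: sympD)
    have "snd r \<in> V" "snd ` set M \<subseteq> V"
      using V r M by auto
    then have MV: "set (map (edge r) M) \<subseteq> V - {0}"
      using okM False by (intro edges_subset) auto
    have V3: "{edge r p, edge r q, ?e} \<subseteq> V - {0}"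
      using e okr False V r by (auto simp: edge_ok_def intro: edge_in_V)
    have "s (A @ edge r p # edge r q # map (edge r) M) =
        s (A @ edge r p # ?e # map (edge r) M) - s (A @ edge r q # ?e # map (edge r) M)"
      by (rule three_term[OF edge_relation]) (use V3 A MV len lenM False in auto)
    moreover have "s (A @ edge r x # ?e # map (edge r) M) = - s (A @ ?e # edge r x # map (edge r) M)"
      if "x = p \<or> x = q" for x
      using that by (intro swap_adjacent) (use V3 A MV len lenM in \<open>auto simp: apartment_tuples_iff\<close>)
    ultimately show ?thesis
      using False by simp
  qed simp
  have "star A (p # q # L) = s (A @ ?e # map (edge p) L)
      - (if fst q = 0 then 0 else s (A @ ?e # map (edge q) L))
      + omit_sum (\<lambda>r M. if fst r = 0 then 0 else s (A @ edge r p # edge r q # map (edge r) M)) L"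
    using p head by (simp add: star_def omit_sum_Cons cong: if_cong)
  also have "omit_sum (\<lambda>r M. if fst r = 0 then 0 else s (A @ edge r p # edge r q # map (edge r) M)) L =
      omit_sum (\<lambda>r M. if fst r = 0 then 0 else s (A @ ?e # edge r q # map (edge r) M)) L -
      omit_sum (\<lambda>r M. if fst r = 0 then 0 else s (A @ ?e # edge r p # map (edge r) M)) L"
    unfolding omit_sum_diff[symmetric] by (rule omit_sum_cong) (rule tail, auto)
  finally show ?thesis
    using p by (simp add: star_def omit_sum_Cons cong: if_cong)
qed

text \<open>A point \<open>p\<close> at infinity has no summand of its own, and its edge from any
  finite point is a nonzero multiple of \<open>snd p\<close>. After rescaling, it is a fixed entry
  of all summands; the sign comes from the shift of positions.\<close>

lemma star_Cons_infinite:
  assumes p: "fst p = 0" and q: "\<exists>q\<in>set L. fst q \<noteq> 0"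
    and len: "length A + Suc (length L) = Suc (dim V)" and A: "set A \<subseteq> V - {0}"
    and V: "snd ` set (p # L) \<subseteq> V" and ok: "sorted_wrt edge_ok (p # L)"
  shows "star A (p # L) = - star (A @ [snd p]) L" "snd p \<noteq> 0"
proof -
  show p0: "snd p \<noteq> 0"
    using q ok p by (auto simp: edge_ok_def edge_def)
  have *: "(if fst r = 0 then 0 else s (A @ edge r p # map (edge r) M)) =
      (if fst r = 0 then 0 else s (A @ snd p # map (edge r) M))"
    if i: "i < length L" "r = L ! i" "M = omit i L" for i r M
  proof (cases "fst r = 0")
    case False
    have r: "r \<in> set L" and M: "set M \<subseteq> set L" and lenM: "Suc (length M) = length L"
      using i set_omit_subset[of i L] by auto
    have okM: "edge_ok r t" if "t \<in> set M" for t
      using sorted_wrt_omit[of edge_ok L i t] ok that i symp_edge_ok by auto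
    have "snd r \<in> V" "snd ` set M \<subseteq> V"
      using V r M by auto
    then have MV: "set (map (edge r) M) \<subseteq> V - {0}"
      using okM False by (intro edges_subset) auto
    have "edge r p = fst r *s snd p"
      using p by (simp add: edge_def)
    then show ?thesis
      using False rescale_at[of A "snd p" "map (edge r) M" "fst r"] MV A V p0 len lenM
      by (simp add: apartment_tuples_iff)
  qed simp
  have "omit_sum (\<lambda>r M. if fst r = 0 then 0 else s (A @ edge r p # map (edge r) M)) L =
      omit_sum (\<lambda>r M. if fst r = 0 then 0 else s (A @ snd p # map (edge r) M)) L"
    by (rule omit_sum_cong) (rule *, auto)
  then show "star A (p # L) = - star (A @ [snd p]) L"
    using p by (simp add: star_def omit_sum_Cons cong: if_cong)
qed

text \<open>Only the summand of \<open>p\<close> survives, and its edges to points at infinity are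
  multiples of their directions.\<close>

lemma star_single_finite:
  assumes "fst p \<noteq> 0" "\<forall>q\<in>set L. fst q = 0"
  shows "star A (p # L) = s (A @ map (\<lambda>q. fst p *s snd q) L)"
proof -
  have "omit_sum (\<lambda>r M. if fst r = 0 then 0 else s (A @ edge r p # map (edge r) M)) L = 0"
    using assms by (intro omit_sum_0) auto
  moreover have m: "map (edge p) L = map (\<lambda>q. fst p *s snd q) L"
    using assms by (auto simp: edge_def)
  ultimately show ?thesis
    using assms by (simp add: star_def omit_sum_Cons m cong: if_cong)
qed

text \<open>Induction through \<open>star_Cons_Cons\<close>: either both stars of the difference
  vanish, or \<open>p\<close> and \<open>q\<close> are the only finite points and the two one-term
  stars agree up to rescaling.\<close>

lemma star_Cons_finite_eq_0:
  assumes "fst p \<noteq> 0" "\<exists>q\<in>set L. fst q \<noteq> 0"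
    and "length A + Suc (length L) = Suc (dim V)" "set A \<subseteq> V - {0}"
    and "snd ` set (p # L) \<subseteq> V" "sorted_wrt edge_ok (p # L)"
  shows "star A (p # L) = 0"
  using assms
proof (induction L arbitrary: p A)
  case (Cons q L)
  let ?e = "edge p q"
  have e: "?e \<in> V - {0}"
    using Cons.prems by (auto simp: edge_ok_def intro: edge_in_V)
  have split: "star A (p # q # L) = star (A @ [?e]) (p # L) - star (A @ [?e]) (q # L)"
    using Cons.prems by (intro star_Cons_Cons) auto
  show ?case
  proof (cases "\<exists>r\<in>set L. fst r \<noteq> 0")
    case True
    have p0: "star (A @ [?e]) (p # L) = 0"
      using Cons.prems True e by (intro Cons.IH) auto
    have "star (A @ [?e]) (q # L) = 0"
    proof (cases "fst q = 0")
      case False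
      then show ?thesis
        using Cons.prems True e by (intro Cons.IH) auto
    next
      case q: True
      \<comment> \<open>With \<open>q\<close> at infinity, \<open>?e\<close> and
        \<open>edge r q\<close> are both multiples of \<open>snd q\<close>, so the tuple is
        dependent.\<close>
      have "(if fst r = 0 then 0 else s ((A @ [?e]) @ edge r q # map (edge r) M)) = 0"
        if i: "i < length L" "r = L ! i" "M = omit i L" for i r M
      proof (cases "fst r = 0")
        case False
        have r: "r \<in> set L" and M: "set M \<subseteq> set L" and lenM: "Suc (length M) = length L"
          using i set_omit_subset[of i L] by auto
        have okM: "edge_ok r t" if "t \<in> set M" for t
          using sorted_wrt_omit[of edge_ok L i t] Cons.prems that i symp_edge_ok by auto
        have "edge_ok r q"
          using Cons.prems r symp_edge_ok by (auto dest: sympD)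
        moreover have "snd r \<in> V" "snd ` set M \<subseteq> V"
          using Cons.prems r M by auto
        ultimately have MV: "set (edge r q # map (edge r) M) \<subseteq> V - {0}"
          using okM False Cons.prems edges_subset[of r "q # M"] by auto
        let ?vs = "A @ ?e # edge r q # map (edge r) M"
        have "\<not> lin_indep_list (*s) ?vs"
        proof
          assume li: "lin_indep_list (*s) ?vs"
          then have d: "?e \<noteq> edge r q" and ind: "independent {?e, edge r q}"
            using dependent_mono[of "{?e, edge r q}" "set ?vs"] by (auto simp: lin_indep_list_def)
          have "fst r *s ?e + (- fst p) *s edge r q = 0"
            using q by (simp add: edge_def mult.commute)
          then have "(\<Sum>x\<in>{?e, edge r q}. (if x = ?e then fst r else - fst p) *s x) = 0"
            using d by simp
          from independentD[OF ind _ _ this, of ?e] show False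
            using False by auto
        qed
        then have "s ?vs = 0"
          using MV e Cons.prems lenM by (intro dependent_0) (auto simp: apartment_tuples_iff)
        then show ?thesis
          by simp
      qed simp
      then have "omit_sum (\<lambda>r M. if fst r = 0 then 0 else s ((A @ [?e]) @ edge r q # map (edge r) M)) L = 0"
        by (intro omit_sum_0) auto
      then show ?thesis
        using q by (simp add: star_def omit_sum_Cons cong: if_cong)
    qed
    with p0 split show ?thesis
      by simp
  next
    case False
    then have L: "\<forall>r\<in>set L. fst r = 0" and q: "fst q \<noteq> 0"
      using Cons.prems by auto
    have "snd r \<in> V - {0}" if "r \<in> set L" for r
      using Cons.prems that L by (auto simp: edge_ok_def edge_def)
    then have LV: "set (map snd L) \<subseteq> V - {0}"
      by auto
    \<comment> \<open>Whether seen from \<open>p\<close> or from \<open>q\<close>, the directions to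
      the points at infinity are the same up to scalars.\<close>
    have "s ((A @ [?e]) @ map (\<lambda>r. fst t *s snd r) L) = s ((A @ [?e]) @ map snd L)"
      if "t \<in> {p, q}" for t
      by (rule rescale_all)
        (use that q LV e Cons.prems in \<open>auto simp: list_all2_conv_all_nth\<close>)
    then show ?thesis
      using split star_single_finite[of p L "A @ [?e]"] star_single_finite[of q L "A @ [?e]"]
        Cons.prems L q by simp
  qed
qed simp

text \<open>Leading points at infinity are moved into the prefix until a finite point comes first;
  another finite point then remains behind it.\<close>

theorem star_eq_0:
  assumes "2 \<le> length (filter (\<lambda>p. fst p \<noteq> 0) L)"
    and "length A + length L = Suc (dim V)" "set A \<subseteq> V - {0}"
    and "snd ` set L \<subseteq> V" "sorted_wrt edge_ok L"
  shows "star A L = 0"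
  using assms
proof (induction L arbitrary: A)
  case (Cons p L)
  have ex: "\<exists>q\<in>set L. fst q \<noteq> 0"
  proof (rule ccontr)
    assume "\<not> ?thesis"
    then have "filter (\<lambda>p. fst p \<noteq> 0) L = []"
      by (simp add: filter_empty_conv)
    then show False
      using Cons.prems(1) by (auto split: if_splits)
  qed
  show ?case
  proof (cases "fst p = 0")
    case False
    then show ?thesis
      using Cons.prems ex by (intro star_Cons_finite_eq_0) auto
  next
    case True
    have p: "star A (p # L) = - star (A @ [snd p]) L" "snd p \<noteq> 0"
      using star_Cons_infinite[OF True ex] Cons.prems by auto
    have "star (A @ [snd p]) L = 0"
      using Cons.prems p True by (intro Cons.IH) auto
    with p show ?thesis
      by simp
  qed
qed simp

end


section \<open>Dual bases\<close>

lemma vector_space_dual_scale: "vector_space (dual_scale :: 'f::field \<Rightarrow> ('v \<Rightarrow> 'f) \<Rightarrow> 'v \<Rightarrow> 'f)"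
  by unfold_locales (auto simp: dual_scale_def fun_eq_iff algebra_simps)

lemma sum_fun_apply: "(\<Sum>a\<in>A. f a) x = (\<Sum>a\<in>A. f a x)"
  by (induction A rule: infinite_finite_induct) auto

text \<open>Only the vanishing pattern of the pairings is prescribed, so each functional is
  determined up to a scalar, as befits lines. For bases this is a computational form of
  \<open>dual_tuple\<close>.\<close>

definition biorthogonal ::
    "('f::field \<Rightarrow> 'v::ab_group_add \<Rightarrow> 'v) \<Rightarrow> 'v list \<Rightarrow> ('v \<Rightarrow> 'f) list \<Rightarrow> bool" where
  "biorthogonal sc vs \<phi>s \<longleftrightarrow> length \<phi>s = length vs \<and> set \<phi>s \<subseteq> dual_space sc \<and>
     (\<forall>i<length vs. \<forall>j<length vs. (\<phi>s ! i) (vs ! j) = 0 \<longleftrightarrow> i \<noteq> j)"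

definition dual_list ::
    "('f::field \<Rightarrow> 'v::ab_group_add \<Rightarrow> 'v) \<Rightarrow> 'v list \<Rightarrow> ('v \<Rightarrow> 'f) list" where
  "dual_list sc vs = (SOME \<phi>s. biorthogonal sc vs \<phi>s)"

text \<open>Dependent tuples have no dual tuple; 0 is the value which the relations force
  there.\<close>

definition pullback ::
    "('f::field \<Rightarrow> 'v::ab_group_add \<Rightarrow> 'v) \<Rightarrow> (('v \<Rightarrow> 'f) list \<Rightarrow> rat) \<Rightarrow> 'v list \<Rightarrow> rat" where
  "pullback sc s vs = (if lin_indep_list sc vs then s (dual_list sc vs) else 0)"

context finite_dimensional_vector_space
begin

interpretation dual: vector_space "dual_scale :: 'a \<Rightarrow> ('b \<Rightarrow> 'a) \<Rightarrow> 'b \<Rightarrow> 'a"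
  by (rule vector_space_dual_scale)

interpretation functional: vector_space_pair scale "(*) :: 'a \<Rightarrow> 'a \<Rightarrow> 'a"
  by (simp add: vector_space_pair_def vector_space_mult vector_space_axioms)

lemma mem_dual_space:
  "\<phi> \<in> dual_space scale \<longleftrightarrow> (\<forall>x y. \<phi> (x + y) = \<phi> x + \<phi> y) \<and> (\<forall>c x. \<phi> (c *s x) = c * \<phi> x)"
  by (simp add: dual_space_def Vector_Spaces.linear_iff vector_space_mult vector_space_axioms)

lemma subspace_dual_space: "dual.subspace (dual_space scale)"
proof (rule dual.subspaceI)
  show "\<phi> + \<psi> \<in> dual_space scale" if "\<phi> \<in> dual_space scale" "\<psi> \<in> dual_space scale" for \<phi> \<psi>
    using that unfolding mem_dual_space plus_fun_apply by (metis add.assoc add.left_commute distrib_left)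
  show "dual_scale c \<phi> \<in> dual_space scale" if "\<phi> \<in> dual_space scale" for c \<phi>
    using that unfolding mem_dual_space dual_scale_def by (metis distrib_left mult.left_commute)
qed (simp add: mem_dual_space)

lemma functional_0_on_span:
  assumes "\<phi> \<in> dual_space scale" "\<And>b. b \<in> B \<Longrightarrow> \<phi> b = 0" "x \<in> span B"
  shows "\<phi> x = 0"
  using functional.linear_eq_0_on_span[of \<phi> B x] assms by (simp add: dual_space_def)

lemma functional_eqI:
  assumes "\<phi> \<in> dual_space scale" "\<psi> \<in> dual_space scale" "span B = UNIV"
    and "\<And>b. b \<in> B \<Longrightarrow> \<phi> b = \<psi> b"
  shows "\<phi> = \<psi>"
  using functional.linear_eq_on[of \<phi> \<psi> _ B] assms by (auto simp: dual_space_def fun_eq_iff)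

lemma span_lin_indep_list:
  assumes "lin_indep_list scale vs" "length vs = dim UNIV"
  shows "span (set vs) = UNIV"
  using assms card_ge_dim_independent[of "set vs" UNIV]
  by (auto simp: lin_indep_list_def distinct_card)

text \<open>The functional with index \<open>i\<close> kills the span of the other vectors but not
  \<open>vs ! i\<close>.\<close>

lemma biorthogonal_imp_lin_indep:
  assumes "biorthogonal scale vs \<phi>s"
  shows "lin_indep_list scale vs"
proof -
  have eq: "vs ! i = vs ! j \<longleftrightarrow> i = j" if "i < length vs" "j < length vs" for i j
    using assms that by (metis biorthogonal_def)
  have "vs ! i \<notin> span (set vs - {vs ! i})" if i: "i < length vs" for i
  proof
    assume "vs ! i \<in> span (set vs - {vs ! i})"
    moreover have "\<phi>s ! i \<in> dual_space scale"
      using assms i by (auto simp: biorthogonal_def)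
    moreover have "(\<phi>s ! i) b = 0" if "b \<in> set vs - {vs ! i}" for b
      using that assms i by (auto simp: biorthogonal_def in_set_conv_nth)
    ultimately have "(\<phi>s ! i) (vs ! i) = 0"
      by (blast intro: functional_0_on_span)
    then show False
      using assms i by (auto simp: biorthogonal_def)
  qed
  then have "independent (set vs)"
    by (auto simp: dependent_def in_set_conv_nth)
  moreover have "distinct vs"
    using eq by (simp add: distinct_conv_nth)
  ultimately show ?thesis
    by (simp add: lin_indep_list_def)
qed

lemma representation_in_dual_space:
  assumes "independent B" "span B = UNIV"
  shows "(\<lambda>x. representation B x b) \<in> dual_space scale"
  using assms by (auto simp: mem_dual_space representation_add representation_scale)

lemma biorthogonal_exists:
  assumes li: "lin_indep_list scale vs" and len: "length vs = dim UNIV"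
  shows "\<exists>\<phi>s. biorthogonal scale vs \<phi>s"
proof -
  have "independent (set vs)" "distinct vs" "span (set vs) = UNIV"
    using li span_lin_indep_list[OF li len] by (auto simp: lin_indep_list_def)
  then have "biorthogonal scale vs (map (\<lambda>v x. representation (set vs) x v) vs)"
    by (auto simp: biorthogonal_def representation_in_dual_space representation_basis
        nth_eq_iff_index_eq)
  then show ?thesis ..
qed

lemma biorthogonal_dual_list:
  "lin_indep_list scale vs \<Longrightarrow> length vs = dim UNIV \<Longrightarrow> biorthogonal scale vs (dual_list scale vs)"
  unfolding dual_list_def by (rule someI_ex, rule biorthogonal_exists)

lemma biorthogonal_imp_dual_tuple:
  assumes bi: "biorthogonal scale vs \<phi>s" and len: "length vs = dim UNIV"
  shows "dual_tuple scale vs \<phi>s"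
  unfolding dual_tuple_def
proof (intro conjI allI impI)
  note li = biorthogonal_imp_lin_indep[OF bi]
  show "length \<phi>s = length vs"
    using bi by (simp add: biorthogonal_def)
  fix i assume i: "i < length vs"
  show \<phi>: "\<phi>s ! i \<in> dual_space scale"
    using bi i by (auto simp: biorthogonal_def)
  have omit: "set (omit i vs) = set vs - {vs ! i}"
    using li i by (simp add: set_omit_distinct lin_indep_list_def)
  have van: "(\<phi>s ! i) x = 0" if "x \<in> span (set (omit i vs))" for x
    by (rule functional_0_on_span[OF \<phi> _ that])
      (use bi i in \<open>auto simp: omit biorthogonal_def in_set_conv_nth\<close>)
  have "x \<in> span (set (omit i vs))" if x: "(\<phi>s ! i) x = 0" for x
  proof -
    \<comment> \<open>Modulo the span of the other vectors, \<open>x\<close> is a multiple of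
      \<open>vs ! i\<close>, where the functional does not vanish.\<close>
    obtain k where k: "x - k *s (vs ! i) \<in> span (set (omit i vs))"
      using span_breakdown[of "vs ! i" "set vs" x] span_lin_indep_list[OF li len] i
      by (auto simp: omit)
    have "(\<phi>s ! i) x = (\<phi>s ! i) (x - k *s (vs ! i)) + k * (\<phi>s ! i) (vs ! i)"
      using \<phi> unfolding mem_dual_space by (metis diff_add_cancel)
    then have "k = 0"
      using x van[OF k] bi i by (simp add: biorthogonal_def)
    then show ?thesis
      using k by simp
  qed
  with van show "{x. (\<phi>s ! i) x = 0} = span (set (omit i vs))"
    by blast
qed

lemma dual_tuple_imp_biorthogonal:
  assumes dt: "dual_tuple scale vs \<phi>s" and li: "lin_indep_list scale vs"
  shows "biorthogonal scale vs \<phi>s"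
proof -
  have "(\<phi>s ! i) (vs ! j) = 0 \<longleftrightarrow> i \<noteq> j" if ij: "i < length vs" "j < length vs" for i j
  proof -
    have "(\<phi>s ! i) (vs ! j) = 0 \<longleftrightarrow> vs ! j \<in> span (set vs - {vs ! i})"
      using dt ij li by (auto simp: dual_tuple_def set_omit_distinct lin_indep_list_def)
    also have "\<dots> \<longleftrightarrow> i \<noteq> j"
    proof
      assume "vs ! j \<in> span (set vs - {vs ! i})"
      then show "i \<noteq> j"
        using li ij by (auto simp: lin_indep_list_def dependent_def)
    next
      assume "i \<noteq> j"
      then show "vs ! j \<in> span (set vs - {vs ! i})"
        using li ij by (intro span_base) (auto simp: lin_indep_list_def nth_eq_iff_index_eq)
    qed
    finally show ?thesis .
  qed
  then show ?thesis
    using dt by (auto simp: biorthogonal_def dual_tuple_def in_set_conv_nth)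
qed

lemma biorthogonal_unique:
  assumes \<phi>: "biorthogonal scale vs \<phi>s" and \<psi>: "biorthogonal scale vs \<psi>s"
    and len: "length vs = dim UNIV"
  shows "list_all2 (\<lambda>\<phi> \<psi>. \<exists>c. c \<noteq> 0 \<and> \<psi> = dual_scale c \<phi>) \<phi>s \<psi>s"
proof (rule list_all2_all_nthI)
  show "length \<phi>s = length \<psi>s"
    using \<phi> \<psi> by (simp add: biorthogonal_def)
  fix i assume "i < length \<phi>s"
  then have i: "i < length vs"
    using \<phi> by (simp add: biorthogonal_def)
  \<comment> \<open>Both functionals vanish at the other basis vectors, so they differ by the ratio
    of their values at \<open>vs ! i\<close>.\<close>
  let ?c = "(\<psi>s ! i) (vs ! i) / (\<phi>s ! i) (vs ! i)"
  have nz: "(\<phi>s ! i) (vs ! i) \<noteq> 0" "(\<psi>s ! i) (vs ! i) \<noteq> 0"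
    using \<phi> \<psi> i by (auto simp: biorthogonal_def)
  have in_dual: "\<phi>s ! i \<in> dual_space scale" "\<psi>s ! i \<in> dual_space scale"
    using \<phi> \<psi> i by (auto simp: biorthogonal_def)
  have "\<psi>s ! i = dual_scale ?c (\<phi>s ! i)"
  proof (rule functional_eqI[OF in_dual(2) _ span_lin_indep_list[OF _ len]])
    show "dual_scale ?c (\<phi>s ! i) \<in> dual_space scale"
      using in_dual subspace_dual_space by (simp add: dual.subspace_scale)
    show "lin_indep_list scale vs"
      using \<phi> by (rule biorthogonal_imp_lin_indep)
    fix b assume "b \<in> set vs"
    then obtain j where j: "j < length vs" "b = vs ! j"
      by (auto simp: in_set_conv_nth)
    then have "(\<phi>s ! i) b = 0 \<longleftrightarrow> i \<noteq> j" "(\<psi>s ! i) b = 0 \<longleftrightarrow> i \<noteq> j"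
      using \<phi> \<psi> i unfolding biorthogonal_def by blast+
    then show "(\<psi>s ! i) b = dual_scale ?c (\<phi>s ! i) b"
      using nz j by (cases "i = j") (auto simp: dual_scale_def)
  qed
  then show "\<exists>c. c \<noteq> 0 \<and> \<psi>s ! i = dual_scale c (\<phi>s ! i)"
    using nz by (intro exI[of _ ?c]) auto
qed

text \<open>The coordinate functionals of \<open>Basis\<close> form a basis of the dual space. Dual
  tuples therefore have the length that apartments of the dual space require.\<close>

lemma dim_dual_space: "dual.dim (dual_space scale) = dim UNIV"
proof -
  let ?\<psi> = "\<lambda>b x. representation Basis x b"
  have mem: "?\<psi> b \<in> dual_space scale" for b
    by (rule representation_in_dual_space) (auto simp: independent_Basis span_Basis)
  have val: "?\<psi> b b' = (if b' = b then 1 else 0)" if "b' \<in> Basis" for b b'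
    using that by (simp add: representation_basis independent_Basis eq_commute)
  have inj: "inj_on ?\<psi> Basis"
  proof (rule inj_onI)
    fix b b' assume "b \<in> Basis" "b' \<in> Basis" "?\<psi> b = ?\<psi> b'"
    then show "b = b'"
      using val[of b b] val[of b b'] by (metis one_neq_zero)
  qed
  have sum_apply: "(\<Sum>b\<in>Basis. dual_scale (c b) (?\<psi> b)) x = (\<Sum>b\<in>Basis. c b * ?\<psi> b x)" for c x
    by (simp add: sum_fun_apply dual_scale_def)
  have eval: "(\<Sum>b\<in>Basis. dual_scale (c b) (?\<psi> b)) b' = c b'" if "b' \<in> Basis" for c b'
    using that finite_Basis by (simp add: sum_apply val if_distrib cong: if_cong)
  have "dual.independent (?\<psi> ` Basis)"
  proof (rule dual.independent_if_scalars_zero)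
    fix c \<psi> assume 0: "(\<Sum>\<psi>\<in>?\<psi> ` Basis. dual_scale (c \<psi>) \<psi>) = 0" and "\<psi> \<in> ?\<psi> ` Basis"
    then obtain b where b: "b \<in> Basis" "\<psi> = ?\<psi> b"
      by blast
    have "(\<Sum>b\<in>Basis. dual_scale (c (?\<psi> b)) (?\<psi> b)) = 0"
      using 0 by (simp add: sum.reindex[OF inj])
    then have "(\<Sum>b\<in>Basis. dual_scale (c (?\<psi> b)) (?\<psi> b)) b = 0"
      by (metis zero_fun_apply)
    then show "c \<psi> = 0"
      unfolding eval[OF b(1)] b(2) .
  qed (simp add: finite_Basis)
  moreover have "dual_space scale \<subseteq> dual.span (?\<psi> ` Basis)"
  proof
    fix \<phi> assume \<phi>: "\<phi> \<in> dual_space scale"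
    let ?S = "\<Sum>b\<in>Basis. dual_scale (\<phi> b) (?\<psi> b)"
    have "?S \<in> dual_space scale"
      by (intro dual.subspace_sum dual.subspace_scale subspace_dual_space mem)
    then have "\<phi> = ?S"
      by (rule functional_eqI[OF \<phi> _ span_Basis]) (simp add: eval)
    also have "?S \<in> dual.span (?\<psi> ` Basis)"
      by (intro dual.span_sum dual.span_scale dual.span_base) auto
    finally show "\<phi> \<in> dual.span (?\<psi> ` Basis)" .
  qed
  moreover have "?\<psi> ` Basis \<subseteq> dual_space scale"
    using mem by blast
  ultimately have "dual.dim (dual_space scale) = card (?\<psi> ` Basis)"
    by (intro dual.dim_unique) auto
  also have "\<dots> = dim UNIV"
    using card_image[OF inj] dim_eq_card[of Basis UNIV] by (simp add: span_Basis independent_Basis)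
  finally show ?thesis .
qed

lemma biorthogonal_apartment_tuples:
  assumes "biorthogonal scale vs \<phi>s" "length vs = dim UNIV"
  shows "\<phi>s \<in> apartment_tuples dual_scale (dual_space scale)"
proof -
  have "\<phi>s ! i \<noteq> 0" if "i < length vs" for i
    using assms that by (metis biorthogonal_def zero_fun_apply)
  then have "0 \<notin> set \<phi>s"
    using assms by (auto simp: in_set_conv_nth biorthogonal_def)
  then show ?thesis
    using assms by (auto simp: apartment_tuples_def biorthogonal_def dim_dual_space)
qed


section \<open>Pulling back symbols along duality\<close>

text \<open>The choice made in \<open>dual_list\<close> is immaterial: biorthogonal tuples differ by
  nonzero scalars, to which \<open>s\<close> is insensitive.\<close>

lemma pullback_eq:
  assumes s: "steinberg_symbol dual_scale (dual_space scale) s"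
    and bi: "biorthogonal scale vs \<phi>s" and len: "length vs = dim UNIV"
  shows "pullback scale s vs = s \<phi>s"
proof -
  interpret S: steinberg_symbol dual_scale "dual_space scale" s by (rule s)
  have li: "lin_indep_list scale vs"
    using bi by (rule biorthogonal_imp_lin_indep)
  have "s ([] @ dual_list scale vs) = s ([] @ \<phi>s)"
  proof (rule S.rescale_all)
    show "list_all2 (\<lambda>\<phi> \<psi>. \<exists>c. c \<noteq> 0 \<and> \<psi> = dual_scale c \<phi>) \<phi>s (dual_list scale vs)"
      using biorthogonal_unique[OF bi biorthogonal_dual_list[OF li len] len] .
  qed (use biorthogonal_apartment_tuples[OF bi len] in \<open>auto simp: apartment_tuples_def\<close>)
  then show ?thesis
    using li by (simp add: pullback_def)
qed

lemma pullback_permute: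
  assumes s: "steinberg_symbol dual_scale (dual_space scale) s"
    and len: "length vs = dim UNIV" and p: "p permutes {..<length vs}"
  shows "pullback scale s (permute_list p vs) = of_int (sign p) * pullback scale s vs"
proof (cases "lin_indep_list scale vs")
  case True
  interpret S: steinberg_symbol dual_scale "dual_space scale" s by (rule s)
  obtain \<phi>s where bi: "biorthogonal scale vs \<phi>s"
    using biorthogonal_exists[OF True len] by blast
  then have len\<phi>: "length \<phi>s = length vs"
    by (simp add: biorthogonal_def)
  then have p\<phi>: "p permutes {..<length \<phi>s}"
    using p by simp
  have lt: "p i < length vs" if "i < length vs" for i
    using permutes_in_image[OF p, of i] that by simp
  have eq: "p i = p j \<longleftrightarrow> i = j" for i j
    using permutes_inj[OF p] by (auto simp: inj_def)
  have "biorthogonal scale (permute_list p vs) (permute_list p \<phi>s)"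
    using bi len\<phi> lt eq
    by (auto simp: biorthogonal_def permute_list_nth[OF p] permute_list_nth[OF p\<phi>] set_permute_list[OF p\<phi>])
  then have "pullback scale s (permute_list p vs) = s (permute_list p \<phi>s)"
    using len by (intro pullback_eq[OF s]) auto
  also have "\<dots> = of_int (sign p) * s \<phi>s"
    by (rule S.permute[OF biorthogonal_apartment_tuples[OF bi len] p\<phi>])
  finally show ?thesis
    using pullback_eq[OF s bi len] by simp
next
  case False
  moreover have "lin_indep_list scale (permute_list p vs) \<longleftrightarrow> lin_indep_list scale vs"
    using p by (simp add: lin_indep_list_def)
  ultimately show ?thesis
    by (simp add: pullback_def)
qed

text \<open>All pairings with the rescaled vector are multiplied by \<open>c\<close>, which
  preserves their vanishing pattern.\<close>

lemma biorthogonal_rescale: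
  assumes bi: "biorthogonal scale vs \<phi>s" and c: "c \<noteq> 0"
  shows "biorthogonal scale (vs[i := c *s (vs ! i)]) \<phi>s"
proof (cases "i < length vs")
  case True
  have "(\<phi>s ! k) (c *s x) = c * (\<phi>s ! k) x" if "k < length vs" for k x
    using bi that mem_dual_space by (metis biorthogonal_def nth_mem subsetD)
  then show ?thesis
    using bi c True by (simp add: biorthogonal_def nth_list_update)
next
  case False
  then show ?thesis
    using bi by (simp add: list_update_beyond)
qed

lemma pullback_rescale:
  assumes s: "steinberg_symbol dual_scale (dual_space scale) s"
    and len: "length vs = dim UNIV" and i: "i < length vs" and c: "c \<noteq> 0"
  shows "pullback scale s (vs[i := c *s (vs ! i)]) = pullback scale s vs"
proof (cases "lin_indep_list scale vs")
  case True
  then obtain \<phi>s where bi: "biorthogonal scale vs \<phi>s"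
    using biorthogonal_exists[OF True len] by blast
  show ?thesis
    using pullback_eq[OF s bi len] pullback_eq[OF s biorthogonal_rescale[OF bi c]] len by simp
next
  case False
  let ?ws = "vs[i := c *s (vs ! i)]"
  have "\<not> lin_indep_list scale ?ws"
  proof
    assume "lin_indep_list scale ?ws"
    then obtain \<phi>s where "biorthogonal scale ?ws \<phi>s"
      using biorthogonal_exists[of ?ws] len by auto
    \<comment> \<open>Scaling back by the inverse of \<open>c\<close> restores
      \<open>vs\<close>.\<close>
    from biorthogonal_rescale[OF this, of "inverse c" i] have "biorthogonal scale vs \<phi>s"
      using c i by simp
    then show False
      using False biorthogonal_imp_lin_indep by blast
  qed
  then show ?thesis
    using False by (simp add: pullback_def)
qed

text \<open>If some \<open>omit k vs\<close> is a basis, \<open>vs\<close> satisfies a single linear relation, with coefficients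
  \<open>a\<close>. If \<open>a i \<noteq> 0\<close>, then \<open>omit i vs\<close> is a basis and its dual lines are generated by the
  functionals \<open>a i \<cdot> \<phi> j - a j \<cdot> \<phi> i\<close>, so the claim is an instance of the star relation.\<close>

lemma pullback_cocycle:
  assumes s: "steinberg_symbol dual_scale (dual_space scale) s"
    and len: "length vs = Suc (dim UNIV)" and nz: "0 \<notin> set vs"
  shows "(\<Sum>i<length vs. (-1) ^ i * pullback scale s (omit i vs)) = 0"
proof (cases "\<exists>i<length vs. lin_indep_list scale (omit i vs)")
  case False
  then show ?thesis
    by (simp add: pullback_def)
next
  case True
  interpret S: steinberg_symbol dual_scale "dual_space scale" s by (rule s)
  from True obtain k where k: "k < length vs" and li: "lin_indep_list scale (omit k vs)"
    by blast
  define n where "n = length vs"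
  define B where "B = set (omit k vs)"
  \<comment> \<open>Coordinates in the basis \<open>B\<close>, with 0 in place of the missing
    coordinate at \<open>k\<close>. Setting \<open>a k = -1\<close> makes \<open>a\<close> the
    coefficients of the relation: the sum of all \<open>a j *s vs ! j\<close> is 0.\<close>
  define \<phi> where "\<phi> j = (if j = k then 0 else (\<lambda>x. representation B x (vs ! j)))" for j
  define a where "a j = (if j = k then -1 else \<phi> j (vs ! k))" for j
  define e where "e i j = S.edge (a i, \<phi> i) (a j, \<phi> j)" for i j
  define L where "L = map (\<lambda>j. (a j, \<phi> j)) [0..<n]"
  have kn: "k < n"
    using k by (simp add: n_def)
  have vs: "vs = map ((!) vs) [0..<n]"
    by (simp add: n_def map_nth)
  have omit_vs: "omit i vs = map ((!) vs) (omit i [0..<n])" for i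
    by (subst vs) (rule omit_map)
  have omit_n: "set (omit i [0..<n]) = {..<n} - {i}" "distinct (omit i [0..<n])"
      "length (omit i [0..<n]) = n - 1" if "i < n" for i
    using that by (auto simp: set_omit_distinct omit_def)
  have indB: "independent B" and spanB: "span B = UNIV"
    using li span_lin_indep_list[OF li] len k by (auto simp: B_def lin_indep_list_def)
  have B: "B = (!) vs ` ({..<n} - {k})"
    by (simp add: B_def omit_vs omit_n[OF kn])
  have inj: "inj_on ((!) vs) ({..<n} - {k})"
    using li omit_n(1)[OF kn] by (simp add: lin_indep_list_def omit_vs distinct_map)
  have \<phi>_dual: "\<phi> j \<in> dual_space scale" for j
    using representation_in_dual_space[OF indB spanB] dual.subspace_0[OF subspace_dual_space]
    by (simp add: \<phi>_def)
  have \<phi>_val: "\<phi> j (vs ! l) = (if j = l then 1 else 0) + (if l = k then a j else 0)"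
    if "j < n" "l < n" for j l
  proof (cases "j = k \<or> l = k")
    case True
    then show ?thesis
      by (auto simp: \<phi>_def a_def)
  next
    case False
    then have "vs ! l \<in> B" "vs ! l = vs ! j \<longleftrightarrow> l = j"
      using that inj by (auto simp: B inj_on_eq_iff)
    then show ?thesis
      using False indB by (auto simp: \<phi>_def representation_basis)
  qed
  \<comment> \<open>The contributions of the case \<open>l = k\<close> of \<open>\<phi>_val\<close>
    cancel, leaving values that involve only the coefficients.\<close>
  have e_val: "e i j (vs ! l) = (if j = l then a i else 0) - (if i = l then a j else 0)"
    if "i < n" "j < n" "l < n" for i j l
    using that by (auto simp: e_def S.edge_def dual_scale_def \<phi>_val algebra_simps)
  have e_dual: "e i j \<in> dual_space scale" for i j
    unfolding e_def by (intro S.edge_in_V) (auto simp: \<phi>_dual)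
  \<comment> \<open>The index \<open>k\<close> gives one finite point; a nonzero coordinate of the
    nonzero vector \<open>vs ! k\<close> gives a second one.\<close>
  have "\<exists>j<n. j \<noteq> k \<and> a j \<noteq> 0"
  proof (rule ccontr)
    assume "\<not> ?thesis"
    then have "representation B (vs ! k) (vs ! j) = 0" if "j < n" "j \<noteq> k" for j
      using that by (auto simp: a_def \<phi>_def split: if_splits)
    then have "representation B (vs ! k) b = 0" if "b \<in> B" for b
      using that unfolding B by blast
    then have "representation B (vs ! k) b = 0" for b
      using representation_ne_zero by blast
    then have "vs ! k = 0"
      using sum_nonzero_representation_eq[OF indB, of "vs ! k"] by (simp add: spanB)
    then show False
      using nz k by (metis nth_mem)
  qed
  then obtain j where j: "j < n" "j \<noteq> k" "a j \<noteq> 0"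
    by blast
  have "S.star [] L = 0"
  proof (rule S.star_eq_0)
    have "{k, j} \<subseteq> {i. i < length L \<and> fst (L ! i) \<noteq> 0}"
      using j k by (auto simp: L_def a_def n_def)
    then have "card {k, j} \<le> card {i. i < length L \<and> fst (L ! i) \<noteq> 0}"
      by (intro card_mono) auto
    then show "2 \<le> length (filter (\<lambda>p. fst p \<noteq> 0) L)"
      using j by (simp add: length_filter_conv_card)
    show "length [] + length L = Suc (dual.dim (dual_space scale))"
      by (simp add: L_def n_def len dim_dual_space)
    show "snd ` set L \<subseteq> dual_space scale"
      by (auto simp: L_def \<phi>_dual)
    \<comment> \<open>The edge takes the value \<open>a i\<close> at \<open>vs ! l\<close> and
      \<open>- a l\<close> at \<open>vs ! i\<close>, so it is nonzero once one of the points is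
      finite.\<close>
    have "S.edge_ok (a i, \<phi> i) (a l, \<phi> l)" if "i < l" "l < n" for i l
      unfolding S.edge_ok_def using e_val[of i l i] e_val[of i l l] that
      by (auto simp: e_def)
    then show "sorted_wrt S.edge_ok L"
      by (simp add: L_def sorted_wrt_map sorted_wrt_iff_nth_less)
  qed simp
  also have "S.star [] L = (\<Sum>i<length vs. (-1) ^ i * pullback scale s (omit i vs))"
    unfolding S.star_def omit_sum_def
  proof (rule sum.cong)
    show "{..<length L} = {..<length vs}"
      by (simp add: L_def n_def)
    fix i assume "i \<in> {..<length vs}"
    then have i: "i < n"
      by (simp add: n_def)
    have "(if a i = 0 then 0 else s (map (S.edge (a i, \<phi> i)) (omit i L))) = pullback scale s (omit i vs)"
    proof (cases "a i = 0")
      case True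
      then have ik: "i \<noteq> k"
        by (auto simp: a_def)
      \<comment> \<open>When \<open>a i = 0\<close>, the functional \<open>\<phi> i\<close> kills
        all other entries but not \<open>vs ! i\<close>, so these entries do not span.\<close>
      have "\<not> lin_indep_list scale (omit i vs)"
      proof
        assume "lin_indep_list scale (omit i vs)"
        then have "vs ! i \<in> span (set (omit i vs))"
          using span_lin_indep_list[of "omit i vs"] i len by (simp add: n_def)
        moreover have "\<phi> i b = 0" if "b \<in> set (omit i vs)" for b
          using that i True by (auto simp: omit_vs omit_n \<phi>_val split: if_splits)
        ultimately have "\<phi> i (vs ! i) = 0"
          using functional_0_on_span \<phi>_dual by blast
        then show False
          using i ik by (simp add: \<phi>_val)
      qed
      then show ?thesis
        using True by (simp add: pullback_def)
    next
      case False
      let ?J = "omit i [0..<n]"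
      have J: "?J ! p < n" "?J ! p \<noteq> i" "i \<noteq> ?J ! p" if "p < n - 1" for p
        using nth_mem[of p ?J] that omit_n[OF i] by auto
      have map: "map (S.edge (a i, \<phi> i)) (omit i L) = map (e i) ?J"
        by (simp add: L_def omit_map e_def)
      \<comment> \<open>For \<open>j \<noteq> i\<close>, the functional \<open>e i j\<close> is
        \<open>a i\<close> at \<open>vs ! j\<close> and can be nonzero elsewhere only at the omitted
        entry \<open>vs ! i\<close>.\<close>
      have "biorthogonal scale (omit i vs) (map (e i) ?J)"
        unfolding biorthogonal_def omit_vs using i J False omit_n[OF i] e_dual
        by (auto simp: e_val nth_eq_iff_index_eq)
      then have "pullback scale s (omit i vs) = s (map (e i) ?J)"
        using i len by (intro pullback_eq[OF s]) (simp_all add: n_def)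
      then show ?thesis
        using False map by simp
    qed
    moreover have "L ! i = (a i, \<phi> i)"
      using i by (simp add: L_def)
    ultimately show "(- 1) ^ i * (if fst (L ! i) = 0 then 0 else s ([] @ map (S.edge (L ! i)) (omit i L))) =
        (- 1) ^ i * pullback scale s (omit i vs)"
      by (simp only: fst_conv append_Nil)
  qed
  finally show ?thesis .
qed

theorem steinberg_symbol_pullback:
  assumes s: "steinberg_symbol dual_scale (dual_space scale) s"
  shows "steinberg_symbol scale UNIV (pullback scale s)"
proof unfold_locales
  show "subspace UNIV"
    by (rule subspace_UNIV)
  show "pullback scale s vs = 0" if "\<not> lin_indep_list scale vs" for vs
    using that by (simp add: pullback_def)
  show "pullback scale s (permute_list p vs) = of_int (sign p) * pullback scale s vs"
    if "vs \<in> apartment_tuples scale UNIV" "p permutes {..<length vs}" for p vs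
    using that by (intro pullback_permute[OF s]) (auto simp: apartment_tuples_def)
  show "pullback scale s (vs[i := c *s (vs ! i)]) = pullback scale s vs"
    if "vs \<in> apartment_tuples scale UNIV" "i < length vs" "c \<noteq> 0" for vs i c
    using that by (intro pullback_rescale[OF s]) (auto simp: apartment_tuples_def)
  show "(\<Sum>i<length vs. (-1) ^ i * pullback scale s (omit i vs)) = 0"
    if "length vs = Suc (dim UNIV)" "set vs \<subseteq> UNIV - {0}" for vs
    using that by (intro pullback_cocycle[OF s]) auto
qed

end


section \<open>Functionals on Steinberg modules\<close>

lemma (in steinberg_symbol) kills_steinberg_rels:
  assumes l: "Vector_Spaces.linear qscale (*) l"
    and single: "\<And>vs. vs \<in> apartment_tuples (*s) V \<Longrightarrow> l (Poly_Mapping.single vs 1) = s vs"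
    and r: "r \<in> steinberg_rels (*s) V"
  shows "l r = 0"
proof -
  interpret l: Vector_Spaces.linear qscale "(*)" l by (rule l)
  have single_c: "l (Poly_Mapping.single vs c) = c * s vs" if "vs \<in> apartment_tuples (*s) V" for vs c
    using l.scale[of c "Poly_Mapping.single vs 1"] single[OF that] by simp
  from r consider
      (1) vs where "r = Poly_Mapping.single vs 1" "vs \<in> apartment_tuples (*s) V"
        "\<not> lin_indep_list (*s) vs"
    | (2) p vs where "r = Poly_Mapping.single (permute_list p vs) 1 - Poly_Mapping.single vs (of_int (sign p))"
        "vs \<in> apartment_tuples (*s) V" "p permutes {..<length vs}"
    | (3) c i vs where "r = Poly_Mapping.single (vs[i := c *s (vs ! i)]) 1 - Poly_Mapping.single vs 1"
        "vs \<in> apartment_tuples (*s) V" "i < length vs" "c \<noteq> 0"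
    | (4) vs where "r = (\<Sum>i<length vs. Poly_Mapping.single (omit i vs) ((-1) ^ i))"
        "length vs = Suc (dim V)" "set vs \<subseteq> V - {0}"
    unfolding steinberg_rels_def Un_iff mem_Collect_eq by blast
  then show ?thesis
  proof cases
    case 1
    then show ?thesis
      by (simp add: single dependent_0)
  next
    case 2
    then have "permute_list p vs \<in> apartment_tuples (*s) V"
      by (simp add: apartment_tuples_iff)
    then show ?thesis
      using 2 by (simp add: l.diff single_c permute)
  next
    case 3
    have "vs ! i \<in> V - {0}"
      using 3 nth_mem[of i vs] unfolding apartment_tuples_iff by blast
    then have "c *s (vs ! i) \<in> V - {0}"
      using 3 subspace_V by (simp add: subspace_scale)
    then have "vs[i := c *s (vs ! i)] \<in> apartment_tuples (*s) V"
      using 3 set_update_subset_insert[of vs i "c *s (vs ! i)"] by (auto simp: apartment_tuples_iff)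
    then show ?thesis
      using 3 by (simp add: l.diff single_c rescale)
  next
    case 4
    have "omit i vs \<in> apartment_tuples (*s) V" if "i < length vs" for i
      using 4 that set_omit_subset[of i vs] by (auto simp: apartment_tuples_iff)
    then have "l r = (\<Sum>i<length vs. (-1) ^ i * s (omit i vs))"
      unfolding 4(1) l.sum by (intro sum.cong) (simp_all add: single_c)
    then show ?thesis
      using cocycle[OF 4(2,3)] by simp
  qed
qed

lemma (in vector_space) steinberg_symbol_functional:
  assumes V: "subspace V" and l: "Vector_Spaces.linear qscale (*) l"
    and R: "\<And>r. r \<in> steinberg_rels scale V \<Longrightarrow> l r = 0"
  shows "steinberg_symbol scale V (\<lambda>vs. l (Poly_Mapping.single vs 1))"
proof -
  interpret l: Vector_Spaces.linear qscale "(*)" l by (rule l)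
  have single: "l (Poly_Mapping.single vs c) = c * l (Poly_Mapping.single vs 1)" for vs c
    using l.scale[of c "Poly_Mapping.single vs 1"] by simp
  show ?thesis
  proof unfold_locales
    show "subspace V" by (rule V)
    show "l (Poly_Mapping.single vs 1) = 0"
      if "vs \<in> apartment_tuples scale V" "\<not> lin_indep_list scale vs" for vs
      by (rule R) (use that in \<open>auto simp: steinberg_rels_def\<close>)
    show "l (Poly_Mapping.single (permute_list p vs) 1) = of_int (sign p) * l (Poly_Mapping.single vs 1)"
      if "vs \<in> apartment_tuples scale V" "p permutes {..<length vs}" for p vs
    proof -
      have "l (Poly_Mapping.single (permute_list p vs) 1 - Poly_Mapping.single vs (of_int (sign p))) = 0"
        by (rule R) (use that in \<open>auto simp: steinberg_rels_def\<close>)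
      then show ?thesis
        by (simp add: l.diff single[of vs "of_int (sign p)"])
    qed
    show "l (Poly_Mapping.single (vs[i := c *s (vs ! i)]) 1) = l (Poly_Mapping.single vs 1)"
      if "vs \<in> apartment_tuples scale V" "i < length vs" "c \<noteq> 0" for vs i c
    proof -
      have "l (Poly_Mapping.single (vs[i := c *s (vs ! i)]) 1 - Poly_Mapping.single vs 1) = 0"
        by (rule R) (use that in \<open>unfold steinberg_rels_def, blast\<close>)
      then show ?thesis
        by (simp add: l.diff)
    qed
    show "(\<Sum>i<length vs. (-1) ^ i * l (Poly_Mapping.single (omit i vs) 1)) = 0"
      if "length vs = Suc (dim V)" "set vs \<subseteq> V - {0}" for vs
    proof -
      have "l (\<Sum>i<length vs. Poly_Mapping.single (omit i vs) ((-1) ^ i)) = 0"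
        by (rule R) (use that in \<open>unfold steinberg_rels_def, blast\<close>)
      then show ?thesis
        by (simp add: l.sum single[of _ "(-1) ^ _"])
    qed
  qed
qed

section \<open>Apartments and their tensors under rescaling and permutation\<close>

lemma (in vector_space) apartment_rescale:
  assumes V: "subspace V" and us: "us \<in> apartment_tuples scale V"
    and scaled: "list_all2 (\<lambda>u v. \<exists>c. c \<noteq> 0 \<and> v = c *s u) us vs"
  shows "apartment scale V vs = apartment scale V us"
  unfolding apartment_def rel_class_eq_iff
proof (rule in_span_if_functionals_vanish)
  fix l assume l: "Vector_Spaces.linear qscale (*) l"
    and R: "\<And>r. r \<in> steinberg_rels scale V \<Longrightarrow> l r = (0::rat)"
  interpret l: Vector_Spaces.linear qscale "(*)" l by (rule l)
  interpret S: steinberg_symbol scale V "\<lambda>vs. l (Poly_Mapping.single vs 1)"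
    using V l R by (rule steinberg_symbol_functional)
  show "l (Poly_Mapping.single vs 1 - Poly_Mapping.single us 1) = 0"
    using S.rescale_all[OF scaled, of "[]"] us by (simp add: S.apartment_tuples_iff l.diff)
qed

lemma apartment_permute:
  assumes "vs \<in> apartment_tuples sc V" "p permutes {..<length vs}"
  shows "apartment sc V (permute_list p vs) = of_int (sign p) \<odot>\<^bsub>St sc V\<^esub> apartment sc V vs"
  unfolding apartment_def St_def presented_space_smult rel_class_eq_iff
  by (rule qs.span_base) (use assms in \<open>auto simp: steinberg_rels_def\<close>)

lemma apartment_carrier:
  "vs \<in> apartment_tuples sc V \<Longrightarrow> apartment sc V vs \<in> carrier (St sc V)"
  unfolding apartment_def St_def carrier_presented_space by (rule imageI) simp

lemma smult_presented_space_carrier: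
  "x \<in> carrier (presented_space X R) \<Longrightarrow> c \<odot>\<^bsub>presented_space X R\<^esub> x \<in> carrier (presented_space X R)"
  using keys_qscale_subset by (fastforce simp: carrier_presented_space)

lemma St2_smult_apartment_tensor:
  "c \<odot>\<^bsub>St2 sc V\<^esub> (c' \<odot>\<^bsub>St2 sc V\<^esub> apartment_tensor sc V vs ws) =
     (c * c') \<odot>\<^bsub>St2 sc V\<^esub> apartment_tensor sc V vs ws"
  "1 \<odot>\<^bsub>St2 sc V\<^esub> apartment_tensor sc V vs ws = apartment_tensor sc V vs ws"
  by (simp_all add: apartment_tensor_def pure_tensor_def St2_def tensor_space_def)

text \<open>Each factor contributes the sign of \<open>p\<close>, and the square of the sign is
  1.\<close>

lemma apartment_tensor_permute:
  assumes vs: "vs \<in> apartment_tuples sc V" and ws: "ws \<in> apartment_tuples sc V"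
    and p: "p permutes {..<vector_space.dim sc V}"
  shows "apartment_tensor sc V (permute_list p vs) (permute_list p ws) = apartment_tensor sc V vs ws"
proof -
  let ?S = "St sc V" and ?c = "of_int (sign p) :: rat"
  have "p permutes {..<length vs}" "p permutes {..<length ws}"
    using assms by (auto simp: apartment_tuples_def)
  then have "apartment_tensor sc V (permute_list p vs) (permute_list p ws) =
      pure_tensor ?S ?S (?c \<odot>\<^bsub>?S\<^esub> apartment sc V vs) (?c \<odot>\<^bsub>?S\<^esub> apartment sc V ws)"
    using vs ws by (simp add: apartment_tensor_def apartment_permute)
  also have "\<dots> = ?c \<odot>\<^bsub>St2 sc V\<^esub> (?c \<odot>\<^bsub>St2 sc V\<^esub> apartment_tensor sc V vs ws)"
    using apartment_carrier[OF vs] apartment_carrier[OF ws] unfolding St_def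
    by (simp add: apartment_tensor_def St2_def St_def smult_presented_space_carrier)
  also have "\<dots> = apartment_tensor sc V vs ws"
    by (simp add: St2_smult_apartment_tensor flip: of_int_mult)
  finally show ?thesis .
qed

lemma apartment_tensor_rev:
  assumes "vs \<in> apartment_tuples sc V" "ws \<in> apartment_tuples sc V"
  shows "apartment_tensor sc V (rev vs) (rev ws) = apartment_tensor sc V vs ws"
proof -
  define n where "n = vector_space.dim sc V"
  \<comment> \<open>Reversal of the first \<open>n\<close> positions, extended by the identity; it
    is its own inverse.\<close>
  define p where "p i = (if i < n then n - Suc i else i)" for i
  have "bij_betw p {..<n} {..<n}"
    by (rule bij_betw_byWitness[where f' = p]) (auto simp: p_def)
  then have p: "p permutes {..<n}"
    by (rule bij_imp_permutes) (auto simp: p_def)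
  have rev: "rev us = permute_list p us" if "length us = n" for us :: "'a list"
    using that p by (intro nth_equalityI) (auto simp: permute_list_nth rev_nth p_def)
  have "length vs = n" "length ws = n"
    using assms by (auto simp: apartment_tuples_def n_def)
  then show ?thesis
    using apartment_tensor_permute[OF assms p[unfolded n_def]] by (simp add: rev)
qed


section \<open>The duality isomorphism\<close>

context finite_dimensional_vector_space
begin

interpretation dual: vector_space "dual_scale :: 'a \<Rightarrow> ('b \<Rightarrow> 'a) \<Rightarrow> 'b \<Rightarrow> 'a"
  by (rule vector_space_dual_scale)

text \<open>The value 0 on all other lists keeps every image inside the combinations of dual
  apartment tuples.\<close>

definition dual_generator :: "'b list \<Rightarrow> (('b \<Rightarrow> 'a) list \<Rightarrow>\<^sub>0 rat)" where
  "dual_generator vs = (if vs \<in> apartment_tuples scale UNIV \<and> lin_indep_list scale vs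
     then Poly_Mapping.single (dual_list scale vs) 1 else 0)"

definition St_dual :: "('b list \<Rightarrow>\<^sub>0 rat) set \<Rightarrow> (('b \<Rightarrow> 'a) list \<Rightarrow>\<^sub>0 rat) set" where
  "St_dual = induced_map (steinberg_rels dual_scale (dual_space scale)) (free_ext dual_generator)"

text \<open>Duality is well defined on one Steinberg factor: followed by a functional that kills the
  dual relations, the map is on generators the pullback of a symbol, hence kills the original
  relations.\<close>

lemma free_ext_dual_generator_rels:
  assumes r: "r \<in> steinberg_rels scale UNIV"
  shows "free_ext dual_generator r \<in> qs.span (steinberg_rels dual_scale (dual_space scale))"
proof (rule in_span_if_functionals_vanish)
  fix l assume l: "Vector_Spaces.linear qscale (*) l"
    and R: "\<And>r. r \<in> steinberg_rels dual_scale (dual_space scale) \<Longrightarrow> l r = (0::rat)"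
  let ?s = "\<lambda>\<phi>s. l (Poly_Mapping.single \<phi>s 1)"
  interpret l: Vector_Spaces.linear qscale "(*)" l by (rule l)
  have "steinberg_symbol dual_scale (dual_space scale) ?s"
    using subspace_dual_space l R by (rule dual.steinberg_symbol_functional)
  then interpret P: steinberg_symbol scale UNIV "pullback scale ?s"
    by (rule steinberg_symbol_pullback)
  have "(l \<circ> free_ext dual_generator) r = 0"
  proof (rule P.kills_steinberg_rels[OF _ _ r])
    show "Vector_Spaces.linear qscale (*) (l \<circ> free_ext dual_generator)"
      using linear_free_ext l by (rule Vector_Spaces.linear_compose)
    show "(l \<circ> free_ext dual_generator) (Poly_Mapping.single vs 1) = pullback scale ?s vs"
      if "vs \<in> apartment_tuples scale UNIV" for vs
      using that by (simp add: dual_generator_def pullback_def l.zero)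
  qed
  then show "l (free_ext dual_generator r) = 0"
    by simp
qed

lemma dual_list_apartment_tuples:
  assumes "vs \<in> apartment_tuples scale UNIV" "lin_indep_list scale vs"
  shows "dual_list scale vs \<in> apartment_tuples dual_scale (dual_space scale)"
  using assms biorthogonal_apartment_tuples biorthogonal_dual_list
  unfolding apartment_tuples_def[of scale] by blast

lemma St_dual_linear: "St_dual \<in> linear_maps (St scale UNIV) (St dual_scale (dual_space scale))"
  unfolding St_dual_def St_def
proof (rule induced_map_linear[OF linear_free_ext free_ext_dual_generator_rels])
  fix f show "Poly_Mapping.keys (free_ext dual_generator f) \<subseteq> apartment_tuples dual_scale (dual_space scale)"
    by (rule keys_free_ext) (auto simp: dual_generator_def dual_list_apartment_tuples)
qed

lemma St_dual_apartment:
  assumes vs: "vs \<in> apartment_tuples scale UNIV" and bi: "biorthogonal scale vs \<phi>s"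
  shows "St_dual (apartment scale UNIV vs) = apartment dual_scale (dual_space scale) \<phi>s"
proof -
  have li: "lin_indep_list scale vs" and len: "length vs = dim UNIV"
    using bi vs by (auto simp: biorthogonal_imp_lin_indep apartment_tuples_def)
  have "St_dual (apartment scale UNIV vs) =
      rel_class (steinberg_rels dual_scale (dual_space scale)) (free_ext dual_generator (Poly_Mapping.single vs 1))"
    unfolding St_dual_def apartment_def
    by (rule induced_map_rel_class[OF linear_free_ext free_ext_dual_generator_rels])
  also have "\<dots> = apartment dual_scale (dual_space scale) (dual_list scale vs)"
    using vs li by (simp add: dual_generator_def apartment_def)
  \<comment> \<open>The chosen dual tuple and \<open>\<phi>s\<close> generate the same
    lines.\<close>
  also have "\<dots> = apartment dual_scale (dual_space scale) \<phi>s"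
    by (rule dual.apartment_rescale[OF subspace_dual_space biorthogonal_apartment_tuples[OF bi len]])
      (rule biorthogonal_unique[OF bi biorthogonal_dual_list[OF li len] len])
  finally show ?thesis .
qed

text \<open>\<open>duality\<close> is chosen by its defining conditions, so they hold for it once
  some map satisfies them. The witness applies \<open>St_dual\<close> to both factors and swaps
  them.\<close>

lemma
  shows duality_linear: "duality scale \<in> linear_maps (St2 scale UNIV) (St2 dual_scale (dual_space scale))"
    and duality_apartment_tensor:
      "\<lbrakk>vs \<in> apartment_tuples scale UNIV; ws \<in> apartment_tuples scale UNIV;
        biorthogonal scale vs \<phi>s; biorthogonal scale ws \<psi>s\<rbrakk> \<Longrightarrow>
        duality scale (apartment_tensor scale UNIV vs ws) =
          apartment_tensor dual_scale (dual_space scale) \<psi>s \<phi>s"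
proof -
  let ?spec = "\<lambda>D. D \<in> linear_maps (St2 scale UNIV) (St2 dual_scale (dual_space scale)) \<and>
     (\<forall>vs ws \<phi>s \<psi>s.
        vs \<in> apartment_tuples scale UNIV \<and> span (set vs) = UNIV \<and>
        ws \<in> apartment_tuples scale UNIV \<and> span (set ws) = UNIV \<and>
        dual_tuple scale vs \<phi>s \<and> dual_tuple scale ws \<psi>s \<longrightarrow>
        D (apartment_tensor scale UNIV vs ws) = apartment_tensor dual_scale (dual_space scale) \<psi>s \<phi>s)"
  have "?spec (swap_tensor (St dual_scale (dual_space scale)) St_dual)"
  proof (intro conjI allI impI; (elim conjE)?)
    show "swap_tensor (St dual_scale (dual_space scale)) St_dual
        \<in> linear_maps (St2 scale UNIV) (St2 dual_scale (dual_space scale))"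
      unfolding St2_def by (rule swap_tensor_linear[OF St_dual_linear])
    have bi: "biorthogonal scale us \<chi>s"
      if "us \<in> apartment_tuples scale UNIV" "span (set us) = UNIV" "dual_tuple scale us \<chi>s" for us \<chi>s
    proof (rule dual_tuple_imp_biorthogonal[OF that(3)])
      \<comment> \<open>A spanning tuple with \<open>dim\<close> entries has no repetitions and is a
        basis.\<close>
      have "dim UNIV \<le> card (set us)"
        using that by (intro span_card_ge_dim) auto
      then have "card (set us) = length us" "card (set us) = dim UNIV"
        using that card_length[of us] by (auto simp: apartment_tuples_def)
      then show "lin_indep_list scale us"
        using card_eq_dim[of "set us" UNIV] that by (simp add: lin_indep_list_def card_distinct)
    qed
    fix vs ws \<phi>s \<psi>s
    assume vs: "vs \<in> apartment_tuples scale UNIV" "span (set vs) = UNIV" "dual_tuple scale vs \<phi>s"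
      and ws: "ws \<in> apartment_tuples scale UNIV" "span (set ws) = UNIV" "dual_tuple scale ws \<psi>s"
    show "swap_tensor (St dual_scale (dual_space scale)) St_dual (apartment_tensor scale UNIV vs ws) =
        apartment_tensor dual_scale (dual_space scale) \<psi>s \<phi>s"
      by (simp add: apartment_tensor_def swap_tensor_pure[OF St_dual_linear]
          St_dual_apartment[OF vs(1) bi[OF vs]] St_dual_apartment[OF ws(1) bi[OF ws]])
  qed
  then have spec: "?spec (duality scale)"
    unfolding duality_def by (rule someI[where P = ?spec])
  then show "duality scale \<in> linear_maps (St2 scale UNIV) (St2 dual_scale (dual_space scale))"
    by blast
  show "duality scale (apartment_tensor scale UNIV vs ws) =
      apartment_tensor dual_scale (dual_space scale) \<psi>s \<phi>s"
    if "vs \<in> apartment_tuples scale UNIV" "ws \<in> apartment_tuples scale UNIV"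
      "biorthogonal scale vs \<phi>s" "biorthogonal scale ws \<psi>s"
  proof -
    have len: "length vs = dim UNIV" "length ws = dim UNIV"
      using that by (auto simp: apartment_tuples_def)
    then have "span (set vs) = UNIV" "span (set ws) = UNIV"
      using that span_lin_indep_list biorthogonal_imp_lin_indep by blast+
    moreover have "dual_tuple scale vs \<phi>s" "dual_tuple scale ws \<psi>s"
      using that len by (auto intro: biorthogonal_imp_dual_tuple)
    ultimately show ?thesis
      using spec that by blast
  qed
qed

lemma biorthogonal_primal_apartment_tuples:
  assumes bi: "biorthogonal scale vs \<phi>s" and len: "length vs = dim UNIV"
  shows "vs \<in> apartment_tuples scale UNIV"
proof -
  have "0 \<notin> set vs"
    using biorthogonal_imp_lin_indep[OF bi] dependent_zero by (auto simp: lin_indep_list_def)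
  then show ?thesis
    using len by (auto simp: apartment_tuples_def)
qed

lemma duality_smult_apartment_tensor:
  assumes "vs \<in> apartment_tuples scale UNIV" "ws \<in> apartment_tuples scale UNIV"
  shows "duality scale (c \<odot>\<^bsub>St2 scale UNIV\<^esub> apartment_tensor scale UNIV vs ws) =
    c \<odot>\<^bsub>St2 dual_scale (dual_space scale)\<^esub> duality scale (apartment_tensor scale UNIV vs ws)"
proof -
  have "apartment_tensor scale UNIV vs ws \<in> carrier (St2 scale UNIV)"
    using assms by (simp add: apartment_tensor_def St2_def pure_tensor_carrier apartment_carrier)
  then show ?thesis
    using duality_linear by (simp add: linear_maps_def)
qed

lemma biorthogonal_map:
  assumes "distinct js" "\<And>i. i \<in> set js \<Longrightarrow> g i \<in> dual_space scale"
    and "\<And>i j. i \<in> set js \<Longrightarrow> j \<in> set js \<Longrightarrow> g i (f j) = (if i = j then 1 else 0)"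
  shows "biorthogonal scale (map f js) (map g js)"
  using assms by (auto simp: biorthogonal_def nth_eq_iff_index_eq)

end

text \<open>Translates between the index reflection that encodes the reversed dual basis and the
  reversed lists produced by \<open>apartment_tensor_rev\<close>.\<close>

lemma map_rev_upt_reflect:
  "map (\<lambda>i. h (d + 1 - i)) (rev [1..<Suc d]) = rev (map h (rev [1..<Suc d]))"
  by (rule nth_equalityI) (auto simp: rev_nth simp del: upt_Suc)

theorem proposition32:
  fixes sc :: "'f::field \<Rightarrow> 'v::ab_group_add \<Rightarrow> 'v"
    and d :: nat
    and v :: "nat \<Rightarrow> 'v"
    and v' :: "nat \<Rightarrow> 'v \<Rightarrow> 'f"
  assumes "vector_space sc"
    and "vector_space.dim sc (UNIV :: 'v set) = d"
    and "inj_on v {1..d}"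
    and "\<not> Modules.module.dependent sc (v ` {1..d})"
    and "Modules.module.span sc (v ` {1..d}) = UNIV"
    and "\<And>i. i \<in> {1..d} \<Longrightarrow> v' i \<in> dual_space sc"
    and "\<And>i j. i \<in> {1..d} \<Longrightarrow> j \<in> {1..d} \<Longrightarrow> v' i (v j) = (if i = j then 1 else 0)"
  shows "duality sc (St_L sc UNIV d v)
           = (-1) ^ d \<odot>\<^bsub>St2 dual_scale (dual_space sc)\<^esub>
               St_I dual_scale (dual_space sc) d (\<lambda>i. v' (d + 1 - i)) \<and>
         duality sc (St_I sc UNIV d v)
           = (-1) ^ d \<odot>\<^bsub>St2 dual_scale (dual_space sc)\<^esub>
               St_L dual_scale (dual_space sc) d (\<lambda>i. v' (d + 1 - i))"
proof -
  interpret vector_space sc by (rule assms(1))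
  interpret finite_dimensional_vector_space sc "v ` {1..d}"
    using assms(4,5) by unfold_locales auto
  interpret dual: vector_space "dual_scale :: 'f \<Rightarrow> ('v \<Rightarrow> 'f) \<Rightarrow> 'v \<Rightarrow> 'f"
    by (rule vector_space_dual_scale)
  let ?I = "rev [1..<Suc d]" and ?V' = "dual_space sc"
  \<comment> \<open>\<open>?gL\<close> is dual to the tail sums \<open>?fL\<close>, and
    \<open>?gI\<close> to the differences \<open>?fI\<close>: summation on one side corresponds to
    differencing on the other. The boundary cases avoid \<open>v' 0\<close> and
    \<open>v (Suc d)\<close>, about which nothing is assumed.\<close>
  let ?fL = "\<lambda>i. \<Sum>j=i..d. v j" and ?gL = "\<lambda>i. if i = 1 then v' 1 else v' i - v' (i - 1)"
  let ?fI = "\<lambda>i. if i = d then v d else v i - v (Suc i)" and ?gI = "\<lambda>i. \<Sum>j=1..i. v' j"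
  note V'[simp] = assms(6) and v'v = assms(7)
  have I: "distinct ?I" "set ?I = {1..d}" "length ?I = d"
    by auto
  have sub: "dual.subspace ?V'"
    by (rule subspace_dual_space)
  have add: "\<phi> (\<Sum>j\<in>J. f j) = (\<Sum>j\<in>J. \<phi> (f j))" "\<phi> (x - y) = \<phi> x - \<phi> y" if "\<phi> \<in> ?V'" for \<phi> f x y and J :: "nat set"
  proof -
    interpret \<phi>: Vector_Spaces.linear sc "(*)" \<phi>
      using that by (simp add: dual_space_def)
    show "\<phi> (\<Sum>j\<in>J. f j) = (\<Sum>j\<in>J. \<phi> (f j))" "\<phi> (x - y) = \<phi> x - \<phi> y"
      by (rule \<phi>.sum, rule \<phi>.diff)
  qed
  have bi: "biorthogonal sc (map v ?I) (map v' ?I)"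
    by (rule biorthogonal_map[OF I(1)], unfold I(2)) (rule V' v'v; assumption)+
  have biL: "biorthogonal sc (map ?fL ?I) (map ?gL ?I)"
  proof (rule biorthogonal_map[OF I(1)])
    fix i assume "i \<in> set ?I"
    then have "i \<in> {1..d}" "i = 1 \<or> i - 1 \<in> {1..d}"
      by auto
    then show "?gL i \<in> ?V'"
      by (auto intro!: dual.subspace_diff[OF sub] V')
  next
    fix i j assume "i \<in> set ?I" "j \<in> set ?I"
    then have ij: "1 \<le> i" "i \<le> d" "1 \<le> j" "j \<le> d"
      by auto
    \<comment> \<open>The sum from \<open>j\<close> to \<open>d\<close> contains \<open>v k\<close>
      iff \<open>j \<le> k\<close>; the step functions for \<open>i\<close> and \<open>i - 1\<close>
      differ exactly at \<open>j = i\<close>.\<close>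
    have val: "v' k (?fL j) = (if j \<le> k then 1 else 0)" if "1 \<le> k" "k \<le> d" for k
      using that ij by (simp add: add v'v)
    show "?gL i (?fL j) = (if i = j then 1 else 0)"
      using ij val[of i] val[of "i - 1"] by (cases "i = 1") auto
  qed
  have biI: "biorthogonal sc (map ?fI ?I) (map ?gI ?I)"
  proof (rule biorthogonal_map[OF I(1)])
    fix i assume "i \<in> set ?I"
    then show "?gI i \<in> ?V'"
      by (intro dual.subspace_sum[OF sub]) auto
  next
    fix i j assume "i \<in> set ?I" "j \<in> set ?I"
    then have ij: "1 \<le> i" "i \<le> d" "1 \<le> j" "j \<le> d"
      by auto
    \<comment> \<open>A step function again: its values at \<open>j\<close> and \<open>Suc j\<close>
      differ exactly when \<open>j = i\<close>.\<close>
    have val: "?gI i (v k) = (if k \<le> i then 1 else 0)" if "1 \<le> k" "k \<le> d" for k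
      using that ij by (simp add: sum_fun_apply v'v)
    have "?gI i \<in> ?V'"
      using ij by (intro dual.subspace_sum[OF sub]) auto
    then show "?gI i (?fI j) = (if i = j then 1 else 0)"
      using ij val[of j] val[of "Suc j"] by (auto simp: add)
  qed
  have len: "length (map f ?I) = dim UNIV" for f :: "nat \<Rightarrow> 'c"
    using assms(2) I(3) by simp
  note primal = biorthogonal_primal_apartment_tuples[OF _ len]
  note dual = biorthogonal_apartment_tuples[OF _ len]
  \<comment> \<open>In the first identity the sign of the claim cancels the one in
    \<open>St_I\<close>; in the second, the sign of \<open>St_I\<close> is the sign of the
    claim.\<close>
  have sign: "(-1) ^ d * (-1) ^ d = (1 :: rat)"
    by (simp flip: power_mult_distrib)
  \<comment> \<open>Duality exchanges the factors, so the dual of \<open>map v ?I\<close> comes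
    first.\<close>
  have "duality sc (St_L sc UNIV d v) = apartment_tensor dual_scale ?V' (map v' ?I) (map ?gL ?I)"
    unfolding St_L_def by (rule duality_apartment_tensor[OF primal[OF biL] primal[OF bi] biL bi])
  also have "\<dots> = apartment_tensor dual_scale ?V' (rev (map v' ?I)) (rev (map ?gL ?I))"
    by (rule apartment_tensor_rev[OF dual[OF bi] dual[OF biL], symmetric])
  also have "rev (map v' ?I) = map (\<lambda>i. v' (d + 1 - i)) ?I"
    by (rule map_rev_upt_reflect[symmetric])
  \<comment> \<open>Reflection turns the special case \<open>i = 1\<close> of \<open>?gL\<close>
    into the special case \<open>i = d\<close> of \<open>St_I\<close>.\<close>
  also have "rev (map ?gL ?I) = map (\<lambda>i. if i = d then v' (d + 1 - d) else v' (d + 1 - i) - v' (d + 1 - Suc i)) ?I"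
    unfolding map_rev_upt_reflect[symmetric] by (rule map_cong) auto
  finally have L: "duality sc (St_L sc UNIV d v) =
      (-1) ^ d \<odot>\<^bsub>St2 dual_scale ?V'\<^esub> St_I dual_scale ?V' d (\<lambda>i. v' (d + 1 - i))"
    by (simp only: St_I_def St2_smult_apartment_tensor sign)
  have "duality sc (St_I sc UNIV d v) = (-1) ^ d \<odot>\<^bsub>St2 dual_scale ?V'\<^esub>
      apartment_tensor dual_scale ?V' (map ?gI ?I) (map v' ?I)"
    unfolding St_I_def duality_smult_apartment_tensor[OF primal[OF bi] primal[OF biI]]
    by (simp only: duality_apartment_tensor[OF primal[OF bi] primal[OF biI] bi biI])
  also have "apartment_tensor dual_scale ?V' (map ?gI ?I) (map v' ?I) =
      apartment_tensor dual_scale ?V' (rev (map ?gI ?I)) (rev (map v' ?I))"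
    by (rule apartment_tensor_rev[OF dual[OF biI] dual[OF bi], symmetric])
  also have "rev (map v' ?I) = map (\<lambda>i. v' (d + 1 - i)) ?I"
    by (rule map_rev_upt_reflect[symmetric])
  also have "rev (map ?gI ?I) = map (\<lambda>i. \<Sum>j=i..d. v' (d + 1 - j)) ?I"
  proof -
    \<comment> \<open>Reflection turns initial sums into the tail sums that occur in
      \<open>St_L\<close>.\<close>
    have "?gI (d + 1 - i) = (\<Sum>j=i..d. v' (d + 1 - j))" if "1 \<le> i" for i
      using that by (intro sum.reindex_bij_witness[of _ "\<lambda>j. d + 1 - j" "\<lambda>j. d + 1 - j"]) auto
    then show ?thesis
      unfolding map_rev_upt_reflect[symmetric] by (intro map_cong) auto
  qed
  finally have "duality sc (St_I sc UNIV d v) =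
      (-1) ^ d \<odot>\<^bsub>St2 dual_scale ?V'\<^esub> St_L dual_scale ?V' d (\<lambda>i. v' (d + 1 - i))"
    by (simp only: St_L_def)
  with L show ?thesis ..
qed

end
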